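(* Let $E$ be a symmetric Banach space on the interval $(0,1)$. For every given $0\le x\in E$, there exists a singular symmetric linear functional $\varphi_{sing}$ on $E$ such that $$\varphi_{sing}(x)=\lim_{m\to\infty}\frac1m\|\sigma_m(\mu(x))\|_E.$$
   Context: For a measurable function $x$ on $(0,1)$, $\mu(t,x)=\inf\{s\ge0:\ |\{|x|>s\}|\le t\}$ (Lebesgue measure) is its decreasing rearrangement. A symmetric Banach space $E$ on $(0,1)$ is a Banach space of (real-valued) functions $E\subset L_1(0,1)$ such that: (a) $x\in E$, $y\in L_1(0,1)$, $\mu(y)=\mu(x)$ imply $y\in E$ and $\|y\|_E=\|x\|_E$; (b) $0\le y\le x\in E$ implies $y\in E$ and $\|y\|_E\le\|x\|_E$. For $m\in\mathbb{N}$ the dilation operator on functions on $(0,1)$ is $(\sigma_mx)(t)=x(t/m)$, $0<t\le1$. A linear functional $\varphi$ on $E$ is symmetric if $\varphi(y)=\varphi(x)$ for all $0\le x,y\in E$ with $\mu(y)=\mu(x)$, and singular if $\varphi=0$ on $(L_1\cap L_\infty)(0,1)=L_\infty(0,1)$. *)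

theory Defs
  imports "HOL-Analysis.Analysis"
begin

text \<open>
  Elements of \<open>L\<^sub>1(0,1)\<close> are represented by functions \<open>real \<Rightarrow> real\<close> whose values outside
  \<open>(0,1)\<close> are irrelevant. Equality and order of elements are almost-everywhere relations on
  \<open>(0,1)\<close>.
\<close>

abbreviation leb01 :: "real measure" where
  "leb01 \<equiv> lebesgue_on {0<..<1}"

text \<open>
  This is only meaningful for measurable \<open>x\<close> and \<open>0 < t\<close>: at \<open>t = 0\<close> the set on the right is
  empty when \<open>x\<close> is essentially unbounded.
\<close>

definition decreasing_rearrangement :: "(real \<Rightarrow> real) \<Rightarrow> real \<Rightarrow> real" where
  "decreasing_rearrangement x t =
     Inf {s. 0 \<le> s \<and> measure leb01 {u \<in> {0<..<1}. \<bar>x u\<bar> > s} \<le> t}"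

definition same_rearrangement :: "(real \<Rightarrow> real) \<Rightarrow> (real \<Rightarrow> real) \<Rightarrow> bool" where
  "same_rearrangement x y \<longleftrightarrow>
     (\<forall>t\<in>{0<..<1}. decreasing_rearrangement x t = decreasing_rearrangement y t)"

definition dilation :: "nat \<Rightarrow> (real \<Rightarrow> real) \<Rightarrow> real \<Rightarrow> real" where
  "dilation m x t = x (t / real m)"

text \<open>
  \<open>E\<close> is the set of all representatives of the elements of the space and \<open>N\<close> is its norm. That
  \<open>E\<close> and \<open>N\<close> are invariant under almost-everywhere equality is a case of \<open>rearrangement_mem\<close> and
  \<open>rearrangement_norm\<close>.
\<close>

locale symmetric_banach_space =
  fixes E :: "(real \<Rightarrow> real) set" and N :: "(real \<Rightarrow> real) \<Rightarrow> real"
  assumes integrable: "\<And>x. x \<in> E \<Longrightarrow> integrable leb01 x"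
    and zero_mem: "(\<lambda>t. 0) \<in> E"
    and add_mem: "\<And>x y. x \<in> E \<Longrightarrow> y \<in> E \<Longrightarrow> (\<lambda>t. x t + y t) \<in> E"
    and scale_mem: "\<And>c x. x \<in> E \<Longrightarrow> (\<lambda>t. c * x t) \<in> E"
    and norm_nonneg: "\<And>x. x \<in> E \<Longrightarrow> 0 \<le> N x"
    and norm_eq_zero_iff: "\<And>x. x \<in> E \<Longrightarrow> N x = 0 \<longleftrightarrow> (AE t in leb01. x t = 0)"
    and norm_triangle: "\<And>x y. x \<in> E \<Longrightarrow> y \<in> E \<Longrightarrow> N (\<lambda>t. x t + y t) \<le> N x + N y"
    and norm_scale: "\<And>c x. x \<in> E \<Longrightarrow> N (\<lambda>t. c * x t) = \<bar>c\<bar> * N x"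
    and complete: "\<And>X :: nat \<Rightarrow> real \<Rightarrow> real. (\<And>n. X n \<in> E) \<Longrightarrow>
        (\<And>e. 0 < e \<Longrightarrow> \<exists>M. \<forall>m\<ge>M. \<forall>n\<ge>M. N (\<lambda>t. X m t - X n t) < e) \<Longrightarrow>
        \<exists>x\<in>E. (\<lambda>n. N (\<lambda>t. X n t - x t)) \<longlonglongrightarrow> 0"
    and rearrangement_mem: "\<And>x y. x \<in> E \<Longrightarrow> integrable leb01 y \<Longrightarrow>
        same_rearrangement y x \<Longrightarrow> y \<in> E"
    and rearrangement_norm: "\<And>x y. x \<in> E \<Longrightarrow> integrable leb01 y \<Longrightarrow>
        same_rearrangement y x \<Longrightarrow> N y = N x"
    and solid_mem: "\<And>x y. x \<in> E \<Longrightarrow> y \<in> borel_measurable leb01 \<Longrightarrow>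
        (AE t in leb01. 0 \<le> y t \<and> y t \<le> x t) \<Longrightarrow> y \<in> E"
    and solid_norm: "\<And>x y. x \<in> E \<Longrightarrow> y \<in> borel_measurable leb01 \<Longrightarrow>
        (AE t in leb01. 0 \<le> y t \<and> y t \<le> x t) \<Longrightarrow> N y \<le> N x"

text \<open>
  The last conjunct makes \<open>\<phi>\<close> well defined on almost-everywhere equivalence classes.
\<close>

definition linear_functional_on ::
    "(real \<Rightarrow> real) set \<Rightarrow> ((real \<Rightarrow> real) \<Rightarrow> real) \<Rightarrow> bool" where
  "linear_functional_on E \<phi> \<longleftrightarrow>
     (\<forall>x\<in>E. \<forall>y\<in>E. \<phi> (\<lambda>t. x t + y t) = \<phi> x + \<phi> y) \<and>
     (\<forall>c. \<forall>x\<in>E. \<phi> (\<lambda>t. c * x t) = c * \<phi> x) \<and>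
     (\<forall>x\<in>E. \<forall>y\<in>E. (AE t in leb01. x t = y t) \<longrightarrow> \<phi> x = \<phi> y)"

definition symmetric_functional_on ::
    "(real \<Rightarrow> real) set \<Rightarrow> ((real \<Rightarrow> real) \<Rightarrow> real) \<Rightarrow> bool" where
  "symmetric_functional_on E \<phi> \<longleftrightarrow>
     (\<forall>x\<in>E. \<forall>y\<in>E. (AE t in leb01. 0 \<le> x t) \<longrightarrow> (AE t in leb01. 0 \<le> y t) \<longrightarrow>
        same_rearrangement y x \<longrightarrow> \<phi> y = \<phi> x)"

text \<open>
  For \<open>E \<noteq> {0}\<close> the space \<open>L\<^sub>\<infinity>(0,1)\<close> is contained in \<open>E\<close>, so the restriction to \<open>E\<close> matters only
  in the trivial case.
\<close>

definition singular_functional_on ::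
    "(real \<Rightarrow> real) set \<Rightarrow> ((real \<Rightarrow> real) \<Rightarrow> real) \<Rightarrow> bool" where
  "singular_functional_on E \<phi> \<longleftrightarrow>
     (\<forall>x\<in>E. (\<exists>C. AE t in leb01. \<bar>x t\<bar> \<le> C) \<longrightarrow> \<phi> x = 0)"

end

theory Submission
  imports Defs "HOL-Probability.Distribution_Functions" "HOL-Library.Function_Algebras"
begin

text \<open>
  Write \<open>d\<^sub>x(s)\<close> for the measure of \<open>{\<bar>x\<bar> > s}\<close>, \<open>F = \<mu>(x)\<close> and \<open>p(m) = N (\<sigma>\<^sub>m F)\<close>. A
  symmetric norm only sees distribution functions: if \<open>d\<^sub>w \<le> m d\<^sub>f\<close> then \<open>N w \<le> m N f\<close>
  (\<open>distribution_le_mult_imp_norm_le\<close>). Hence \<open>p\<close> is increasing with \<open>p(m n) \<le> m p(n)\<close>, and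
  \<open>p(m)/m\<close> converges to its infimum \<open>L\<close>. If \<open>L = 0\<close>, the functional \<open>0\<close> does the job.

  Let \<open>L > 0\<close>. The functional \<open>\<phi>\<close> is an algebraic linear functional, so it exists as soon as \<open>x\<close>
  lies outside a linear subspace that contains every difference \<open>y - z\<close> of equimeasurable
  nonnegative functions and every bounded function of \<open>E\<close>. The subspace used here,
  \<open>small_truncations\<close>, is cut out by a property of Kalton's type: there are \<open>h \<in> E\<close> and \<open>K\<close>
  such that the integral of \<open>w\<close> over \<open>{g > r}\<close> is at most \<open>K (r + 1) d\<^sub>g(r)\<close> in absolute value
  for all \<open>g \<ge> h\<close> and \<open>r \<ge> 0\<close>. For \<open>w = y - z\<close> this holds with \<open>h = y + z\<close>, because \<open>y\<close> and
  \<open>z\<close> have equal integrals over \<open>{y > r}\<close> and \<open>{z > r}\<close>, and replacing these sets by \<open>{g > r}\<close>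
  adds only points at which the integrand is at most \<open>r\<close>.

  It remains to see that a nonnegative \<open>x\<close> in this subspace has \<open>L = 0\<close>. Applied with
  \<open>r = \<mu>(t,g)\<close>, the property bounds the mean of \<open>F\<close> over \<open>(0,t)\<close> by \<open>C (\<mu>(t,g) + 1)\<close>. In terms
  of \<open>a\<^sub>i = F(1/2^i)/2^i\<close>, at most twice the mass of \<open>F\<close> on the dyadic level
  \<open>[1/2^(i+1),1/2^i)\<close>, this says that some step function of \<open>E\<close> with value \<open>v\<^sub>l\<close> on level \<open>l\<close>
  satisfies \<open>a\<^sub>l + ... + a\<^sub>l\<^sub>+\<^sub>n \<le> v\<^sub>l/2^l\<close> for all \<open>n\<close> (\<open>dyadic_sum_le\<close>). So level \<open>l\<close> of the step
  function holds one portion of mass of order \<open>a\<^sub>i\<close> for each \<open>i\<close> from \<open>l\<close> to \<open>l + n\<close>. The portion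
  with index \<open>i\<close> is moved to the coarser level \<open>j = i - n\<close>. Then level \<open>j\<close> receives \<open>a\<^sub>j\<^sub>+\<^sub>n\<close> from
  each of the \<open>n + 1\<close> levels \<open>j, ..., j + n\<close>, whereas the function \<open>\<sigma>\<^sub>m F / m\<close> with \<open>m = 2^(n-1)\<close> has
  mass at most \<open>a\<^sub>j\<^sub>+\<^sub>n\<close> there. The transport is an average of functions whose distribution functions
  are at most that of the step function, so it increases the norm by no more than a constant
  factor (\<open>norm_shifted_levels_le\<close>). Therefore \<open>p(2^n)/2^n\<close> is at most a constant divided by
  \<open>n + 1\<close>, and \<open>L = 0\<close>.
\<close>

section \<open>Distribution functions and decreasing rearrangements\<close>

definition distribution_fun :: "(real \<Rightarrow> real) \<Rightarrow> real \<Rightarrow> real" where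
  "distribution_fun x s = measure leb01 {u \<in> {0<..<1}. \<bar>x u\<bar> > s}"

lemma prob_space_leb01: "prob_space leb01"
  by (rule prob_spaceI) (simp add: emeasure_restrict_space)

lemma measure_leb01_interval:
  assumes "A \<in> {{a<..<b}, {a..<b}}" "0 \<le> a" "a \<le> b" "b \<le> 1"
  shows "measure leb01 ({0<..<1} \<inter> A) = b - a" "{0<..<1} \<inter> A \<in> sets leb01"
proof -
  have A: "A \<in> sets lebesgue"
    using assms(1) by auto
  then show "{0<..<1} \<inter> A \<in> sets leb01"
    by (auto simp: sets_restrict_space)
  have *: "{a<..<b} \<subseteq> {0<..<1}"
    using assms by auto
  have "measure leb01 ({0<..<1} \<inter> A) = measure lebesgue ({0<..<1} \<inter> A)"
    by (subst measure_restrict_space) auto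
  also have "\<dots> = b - a"
  proof (rule antisym)
    have "measure lebesgue ({0<..<1} \<inter> A) \<le> measure lebesgue {a..b}"
      using assms(1) A by (intro measure_mono_fmeasurable) auto
    also have "\<dots> = b - a" using assms by simp
    finally show "measure lebesgue ({0<..<1} \<inter> A) \<le> b - a" .
    have "b - a = measure lebesgue {a<..<b}" using assms by simp
    also have "\<dots> \<le> measure lebesgue ({0<..<1} \<inter> A)"
    proof (rule measure_mono_fmeasurable)
      show "{a<..<b} \<subseteq> {0<..<1} \<inter> A" using assms(1) * by auto
      show "{0<..<1} \<inter> A \<in> lmeasurable"
        using A by (metis fmeasurable.Int fmeasurable_Int_fmeasurable lmeasurable_box
            box_real(1))
    qed auto
    finally show "b - a \<le> measure lebesgue ({0<..<1} \<inter> A)" .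
  qed
  finally show "measure leb01 ({0<..<1} \<inter> A) = b - a" .
qed

lemma superlevel_sets:
  fixes x :: "real \<Rightarrow> real"
  assumes "x \<in> borel_measurable leb01"
  shows "{u \<in> {0<..<1}. \<bar>x u\<bar> > s} \<in> sets leb01"
proof -
  have "{u \<in> space leb01. \<bar>x u\<bar> > s} \<in> sets leb01"
    using borel_measurable_less[OF borel_measurable_const borel_measurable_abs[OF assms], of s]
    by simp
  then show ?thesis by simp
qed

lemma distribution_fun_nonneg: "0 \<le> distribution_fun x s"
  and distribution_fun_le_1: "distribution_fun x s \<le> 1"
  using prob_space.prob_le_1[OF prob_space_leb01] by (auto simp: distribution_fun_def)

lemma distribution_fun_mono:
  assumes "y \<in> borel_measurable leb01" "AE t in leb01. \<bar>x t\<bar> \<le> \<bar>y t\<bar>" "s \<le> r"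
  shows "distribution_fun x r \<le> distribution_fun y s"
proof -
  interpret prob_space leb01 by (rule prob_space_leb01)
  show ?thesis
    unfolding distribution_fun_def
  proof (rule finite_measure_mono_AE)
    show "AE u in leb01. u \<in> {u \<in> {0<..<1}. \<bar>x u\<bar> > r} \<longrightarrow> u \<in> {u \<in> {0<..<1}. \<bar>y u\<bar> > s}"
      using assms(2) by eventually_elim (use assms(3) in auto)
  qed (rule superlevel_sets[OF assms(1)])
qed

lemma distribution_fun_antimono:
  assumes "x \<in> borel_measurable leb01" "s \<le> r"
  shows "distribution_fun x r \<le> distribution_fun x s"
  by (rule distribution_fun_mono) (use assms in auto)

lemma distribution_fun_right_continuous:
  assumes x: "x \<in> borel_measurable leb01" and t: "t < distribution_fun x s"
  shows "\<exists>r>s. t < distribution_fun x r"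
proof -
  interpret prob_space leb01 by (rule prob_space_leb01)
  let ?A = "\<lambda>n::nat. {u \<in> {0<..<1}. \<bar>x u\<bar> > s + 1 / real (Suc n)}"
  have "(\<lambda>n. measure leb01 (?A n)) \<longlonglongrightarrow> measure leb01 (\<Union>n. ?A n)"
  proof (rule finite_Lim_measure_incseq)
    show "incseq ?A"
    proof (rule incseq_SucI)
      fix n
      have "1 / real (Suc (Suc n)) \<le> 1 / real (Suc n)" by (intro divide_left_mono) auto
      then show "?A n \<subseteq> ?A (Suc n)" by (auto simp del: of_nat_Suc)
    qed
  qed (use superlevel_sets[OF x] in blast)
  also have "(\<Union>n. ?A n) = {u \<in> {0<..<1}. \<bar>x u\<bar> > s}"
  proof (intro equalityI subsetI)
    fix u assume u: "u \<in> {u \<in> {0<..<1}. \<bar>x u\<bar> > s}"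
    then obtain n where "inverse (real (Suc n)) < \<bar>x u\<bar> - s"
      using reals_Archimedean[of "\<bar>x u\<bar> - s"] by auto
    with u show "u \<in> (\<Union>n. ?A n)"
      by (auto simp: field_simps intro!: exI[of _ n])
  next
    fix u assume "u \<in> (\<Union>n. ?A n)"
    then obtain n where n: "u \<in> ?A n" by blast
    have "s < s + 1 / real (Suc n)" by simp
    also have "\<dots> < \<bar>x u\<bar>" using n by blast
    finally show "u \<in> {u \<in> {0<..<1}. \<bar>x u\<bar> > s}" using n by simp
  qed
  finally have "eventually (\<lambda>n. t < measure leb01 (?A n)) sequentially"
    using t by (intro order_tendstoD) (auto simp: distribution_fun_def)
  then obtain n where n: "t < measure leb01 (?A n)"
    by (auto simp: eventually_sequentially)
  have "s < s + 1 / real (Suc n)" by simp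
  with n show ?thesis unfolding distribution_fun_def by blast
qed

lemma distribution_fun_vanishes:
  assumes x: "x \<in> borel_measurable leb01" and t: "0 < t"
  shows "\<exists>s\<ge>0. distribution_fun x s \<le> t"
proof -
  interpret prob_space leb01 by (rule prob_space_leb01)
  let ?A = "\<lambda>n::nat. {u \<in> {0<..<1}. \<bar>x u\<bar> > real n}"
  have "(\<lambda>n. measure leb01 (?A n)) \<longlonglongrightarrow> measure leb01 (\<Inter>n. ?A n)"
    using superlevel_sets[OF x] by (intro finite_Lim_measure_decseq) (force simp: decseq_def)+
  also have "(\<Inter>n. ?A n) = {}"
    by (auto, meson reals_Archimedean2 not_less order.asym)
  finally have "eventually (\<lambda>n. measure leb01 (?A n) < t) sequentially"
    using t by (intro order_tendstoD) auto
  then obtain n where "measure leb01 (?A n) < t"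
    by (auto simp: eventually_sequentially)
  then show ?thesis unfolding distribution_fun_def by (intro exI[of _ "real n"]) auto
qed

text \<open>
  Right continuity of the distribution function makes the infimum in the definition of \<open>\<mu>(t,x)\<close>
  attained, which gives strict inequalities on both sides.
\<close>

lemma decreasing_rearrangement_gt_iff:
  assumes x: "x \<in> borel_measurable leb01" and "0 < t" "0 \<le> s"
  shows "s < decreasing_rearrangement x t \<longleftrightarrow> t < distribution_fun x s"
proof -
  let ?S = "{s. 0 \<le> s \<and> distribution_fun x s \<le> t}"
  have dr: "decreasing_rearrangement x t = Inf ?S"
    by (simp add: decreasing_rearrangement_def distribution_fun_def)
  have ne: "?S \<noteq> {}" using distribution_fun_vanishes[OF x \<open>0 < t\<close>] by blast
  have bdd: "bdd_below ?S" by (rule bdd_belowI[of _ 0]) auto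
  show ?thesis
  proof
    assume "s < decreasing_rearrangement x t"
    then show "t < distribution_fun x s"
      using cInf_lower[OF _ bdd, of s] assms(3) by (force simp: dr)
  next
    assume "t < distribution_fun x s"
    then obtain r where r: "s < r" "t < distribution_fun x r"
      using distribution_fun_right_continuous[OF x] by blast
    have "r \<le> Inf ?S"
    proof (rule cInf_greatest[OF ne])
      fix q assume "q \<in> ?S"
      then show "r \<le> q"
        using distribution_fun_antimono[OF x, of q r] r(2) by force
    qed
    with r(1) show "s < decreasing_rearrangement x t" by (simp add: dr)
  qed
qed

lemma decreasing_rearrangement_nonneg:
  assumes x: "x \<in> borel_measurable leb01" and "0 < t"
  shows "0 \<le> decreasing_rearrangement x t"
  unfolding decreasing_rearrangement_def
  using distribution_fun_vanishes[OF assms]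
  by (intro cInf_greatest) (auto simp: distribution_fun_def)

lemma decreasing_rearrangement_antimono:
  assumes x: "x \<in> borel_measurable leb01" and "0 < t" "t \<le> u"
  shows "decreasing_rearrangement x u \<le> decreasing_rearrangement x t"
proof (rule ccontr)
  assume "\<not> ?thesis"
  then have "decreasing_rearrangement x t < decreasing_rearrangement x u" by simp
  then show False
    using decreasing_rearrangement_gt_iff[OF x, of u "decreasing_rearrangement x t"]
      decreasing_rearrangement_gt_iff[OF x, of t "decreasing_rearrangement x t"]
      decreasing_rearrangement_nonneg[OF x, of t] assms by auto
qed

lemma distribution_fun_decreasing_rearrangement_le:
  assumes x: "x \<in> borel_measurable leb01" and "0 < t"
  shows "distribution_fun x (decreasing_rearrangement x t) \<le> t"
  using decreasing_rearrangement_gt_iff[OF x, of t "decreasing_rearrangement x t"]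
    decreasing_rearrangement_nonneg[OF assms] assms by auto

lemma borel_measurable_antimono01:
  fixes f :: "real \<Rightarrow> real"
  assumes "\<And>t u. 0 < t \<Longrightarrow> t \<le> u \<Longrightarrow> u < 1 \<Longrightarrow> f u \<le> f t"
  shows "f \<in> borel_measurable leb01"
proof -
  let ?g = "\<lambda>t::real. - f t"
  have "mono_on {0<..<1} ?g" using assms by (auto simp: mono_on_def)
  then have "?g \<in> borel_measurable (restrict_space borel {0<..<1})"
    by (rule borel_measurable_mono_on_fnc)
  then have "(\<lambda>t. - ?g t) \<in> borel_measurable (restrict_space borel {0<..<1})"
    by (rule borel_measurable_uminus)
  then have "(\<lambda>t. indicator {0<..<1} t * f t) \<in> borel_measurable borel"
    by (subst (asm) borel_measurable_restrict_space_iff) auto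
  also have "(\<lambda>t. indicator {0<..<1} t * f t) = (\<lambda>t. if t \<in> {0<..<1} then f t else 0)"
    by (auto simp: indicator_def)
  finally have "(\<lambda>t. if t \<in> {0<..<1} then f t else 0) \<in> borel_measurable borel" .
  then have "(\<lambda>t. if t \<in> {0<..<1} then f t else 0) \<in> borel_measurable lebesgue"
    by (simp add: measurable_completion)
  then show ?thesis
    by (subst (asm) borel_measurable_if) auto
qed

lemma decreasing_rearrangement_measurable:
  assumes "x \<in> borel_measurable leb01"
  shows "decreasing_rearrangement x \<in> borel_measurable leb01"
  using decreasing_rearrangement_antimono[OF assms] by (intro borel_measurable_antimono01) auto

text \<open>
  Since \<open>\<mu>(x)\<close> decreases, dilation by \<open>k\<close> stretches the initial interval \<open>{\<mu>(x) > s}\<close> by \<open>k\<close> and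
  cuts it off at \<open>1\<close>.
\<close>

lemma superlevel_dilation:
  assumes x: "x \<in> borel_measurable leb01" and "0 < k" "0 \<le> s"
  shows "{u \<in> {0<..<1}. \<bar>dilation k (decreasing_rearrangement x) u\<bar> > s} =
         {0<..<1} \<inter> {0<..<min 1 (real k * distribution_fun x s)}"
proof -
  have "\<bar>dilation k (decreasing_rearrangement x) u\<bar> > s \<longleftrightarrow> u < real k * distribution_fun x s"
    if "0 < u" for u
  proof -
    have u: "0 < u / real k" using that assms(2) by simp
    show ?thesis
      using decreasing_rearrangement_gt_iff[OF x u assms(3)] decreasing_rearrangement_nonneg[OF x u]
        assms(2) by (simp add: dilation_def pos_divide_less_eq mult.commute)
  qed
  then show ?thesis by auto
qed

lemma distribution_fun_dilation:
  assumes x: "x \<in> borel_measurable leb01" and "0 < k" "0 \<le> s"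
  shows "distribution_fun (dilation k (decreasing_rearrangement x)) s =
         min 1 (real k * distribution_fun x s)"
proof -
  let ?b = "min 1 (real k * distribution_fun x s)"
  have "measure leb01 ({0<..<1} \<inter> {0<..<?b}) = ?b - 0"
    using distribution_fun_nonneg[of x s] by (intro measure_leb01_interval(1)) auto
  then show ?thesis
    unfolding distribution_fun_def[of "dilation k _"] superlevel_dilation[OF assms] by simp
qed

lemma dilation_1 [simp]: "dilation 1 f = f" "dilation (Suc 0) f = f"
  by (auto simp: dilation_def)

lemma distribution_fun_decreasing_rearrangement:
  assumes "x \<in> borel_measurable leb01" "0 \<le> s"
  shows "distribution_fun (decreasing_rearrangement x) s = distribution_fun x s"
  using distribution_fun_dilation[OF assms(1), of 1 s] assms(2) distribution_fun_le_1[of x s]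
  by simp

text \<open>
  By \<open>decreasing_rearrangement_gt_iff\<close> the value \<open>d\<^sub>x(s)\<close> is the supremum of the \<open>t\<close> in \<open>(0,1)\<close> with
  \<open>\<mu>(t,x) > s\<close>. All later arguments can thus use distribution functions in place of rearrangements.
\<close>

lemma same_rearrangement_iff:
  assumes x: "x \<in> borel_measurable leb01" and y: "y \<in> borel_measurable leb01"
  shows "same_rearrangement x y \<longleftrightarrow> (\<forall>s\<ge>0. distribution_fun x s = distribution_fun y s)"
proof
  assume "\<forall>s\<ge>0. distribution_fun x s = distribution_fun y s"
  then have "{s. 0 \<le> s \<and> distribution_fun x s \<le> t} = {s. 0 \<le> s \<and> distribution_fun y s \<le> t}" for t
    by auto
  then show "same_rearrangement x y"
    by (simp add: same_rearrangement_def decreasing_rearrangement_def distribution_fun_def)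
next
  have *: "distribution_fun x s \<le> distribution_fun y s"
    if xy: "same_rearrangement x y" and "0 \<le> s"
      and x: "x \<in> borel_measurable leb01" and y: "y \<in> borel_measurable leb01" for x y s
  proof (rule ccontr)
    assume "\<not> ?thesis"
    then obtain t where t: "distribution_fun y s < t" "t < distribution_fun x s"
      by (meson dense not_le)
    then have "0 < t" "t < 1"
      using distribution_fun_nonneg[of y s] distribution_fun_le_1[of x s] by auto
    then show False
      using t xy that(2) decreasing_rearrangement_gt_iff[OF x, of t s]
        decreasing_rearrangement_gt_iff[OF y, of t s]
      by (auto simp: same_rearrangement_def)
  qed
  assume "same_rearrangement x y"
  then show "\<forall>s\<ge>0. distribution_fun x s = distribution_fun y s"
    using *[of x y] *[of y x] x y by (auto simp: same_rearrangement_def intro!: antisym)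
qed

text \<open>
  The distribution function gives the tails of the image measure under \<open>\<bar>x\<bar>\<close>, which determine that
  measure and with it all integrals of Borel functions of \<open>\<bar>x\<bar>\<close>.
\<close>

lemma distr_abs_eq:
  assumes x: "x \<in> borel_measurable leb01" and y: "y \<in> borel_measurable leb01"
    and xy: "\<And>s. 0 \<le> s \<Longrightarrow> distribution_fun x s = distribution_fun y s"
  shows "distr leb01 borel (\<lambda>t. \<bar>x t\<bar>) = distr leb01 borel (\<lambda>t. \<bar>y t\<bar>)"
proof -
  interpret prob_space leb01 by (rule prob_space_leb01)
  have [measurable]: "x \<in> borel_measurable leb01" "y \<in> borel_measurable leb01" by fact+
  have cdf: "cdf (distr leb01 borel (\<lambda>t. \<bar>z t\<bar>)) s = (if s < 0 then 0 else 1 - distribution_fun z s)"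
    if [measurable]: "z \<in> borel_measurable leb01" for z s
  proof -
    have "cdf (distr leb01 borel (\<lambda>t. \<bar>z t\<bar>)) s = measure leb01 {u \<in> space leb01. \<bar>z u\<bar> \<le> s}"
      unfolding cdf_def by (subst measure_distr) (auto intro!: arg_cong[where f = "measure leb01"])
    also have "{u \<in> space leb01. \<bar>z u\<bar> \<le> s} = space leb01 - {u \<in> {0<..<1}. \<bar>z u\<bar> > s}"
      by auto
    also have "measure leb01 \<dots> = 1 - distribution_fun z s"
      unfolding distribution_fun_def by (rule prob_compl[OF superlevel_sets[OF that]])
    finally have *: "cdf (distr leb01 borel (\<lambda>t. \<bar>z t\<bar>)) s = 1 - distribution_fun z s" .
    show ?thesis
    proof (cases "s < 0")
      case True
      then have "{u \<in> {0<..<1}. \<bar>z u\<bar> > s} = space leb01" by auto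
      then have "distribution_fun z s = 1" unfolding distribution_fun_def
        by (metis prob_space)
      with True * show ?thesis by simp
    qed (use * in auto)
  qed
  show ?thesis
    by (rule cdf_unique) (auto simp: cdf xy)
qed

lemma integrable_equimeasurable:
  assumes x: "x \<in> borel_measurable leb01" and y: "integrable leb01 y"
    and xy: "\<And>s. 0 \<le> s \<Longrightarrow> distribution_fun x s = distribution_fun y s"
  shows "integrable leb01 x"
proof -
  have y': "y \<in> borel_measurable leb01" using y by auto
  have [measurable]: "x \<in> borel_measurable leb01" "y \<in> borel_measurable leb01" by fact+
  have "integrable leb01 (\<lambda>t. \<bar>y t\<bar>)" using y by simp
  then have "integrable (distr leb01 borel (\<lambda>t. \<bar>y t\<bar>)) (\<lambda>u. u)"
    by (subst integrable_distr_eq) auto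
  then have "integrable (distr leb01 borel (\<lambda>t. \<bar>x t\<bar>)) (\<lambda>u. u)"
    by (simp add: distr_abs_eq[OF x y' xy])
  then have "integrable leb01 (\<lambda>t. \<bar>x t\<bar>)"
    by (subst (asm) integrable_distr_eq) auto
  then show ?thesis using integrable_abs_iff[OF x] by simp
qed

lemma integral_truncation_equimeasurable:
  fixes r :: real
  assumes x: "x \<in> borel_measurable leb01" and y: "y \<in> borel_measurable leb01"
    and "AE t in leb01. 0 \<le> x t" "AE t in leb01. 0 \<le> y t"
    and xy: "\<And>s. 0 \<le> s \<Longrightarrow> distribution_fun x s = distribution_fun y s"
  shows "(\<integral>t. x t * indicator {t. x t > r} t \<partial>leb01) = (\<integral>t. y t * indicator {t. y t > r} t \<partial>leb01)"
proof -
  have *: "(\<integral>t. z t * indicator {t. z t > r} t \<partial>leb01) =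
        (\<integral>u. u * indicator {r<..} u \<partial>distr leb01 borel (\<lambda>t. \<bar>z t\<bar>))"
    if [measurable]: "z \<in> borel_measurable leb01" and nn: "AE t in leb01. 0 \<le> z t" for z
  proof -
    have "(\<integral>u. u * indicator {r<..} u \<partial>distr leb01 borel (\<lambda>t. \<bar>z t\<bar>)) =
        (\<integral>t. \<bar>z t\<bar> * indicator {r<..} \<bar>z t\<bar> \<partial>leb01)"
      by (subst integral_distr) auto
    also have "\<dots> = (\<integral>t. z t * indicator {t. z t > r} t \<partial>leb01)"
    proof (rule integral_cong_AE)
      show "AE t in leb01. \<bar>z t\<bar> * indicator {r<..} \<bar>z t\<bar> = z t * indicator {t. z t > r} t"
        using nn by eventually_elim (auto simp: indicator_def)
      have "(\<lambda>t. if z t > r then z t else 0) \<in> borel_measurable leb01" by measurable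
      also have "(\<lambda>t. if z t > r then z t else 0) = (\<lambda>t. z t * indicator {t. z t > r} t)"
        by (auto simp: indicator_def)
      finally show "(\<lambda>t. z t * indicator {t. z t > r} t) \<in> borel_measurable leb01" .
    qed measurable
    finally show ?thesis by simp
  qed
  show ?thesis using assms by (simp add: * distr_abs_eq[OF x y xy])
qed

section \<open>Norm estimates from distribution functions\<close>

context symmetric_banach_space
begin

lemma measurable_E: "x \<in> E \<Longrightarrow> x \<in> borel_measurable leb01"
  using integrable by auto

lemma decreasing_rearrangement_mem:
  assumes "x \<in> E"
  shows "decreasing_rearrangement x \<in> E" "N (decreasing_rearrangement x) = N x"
proof -
  have x: "x \<in> borel_measurable leb01" by (rule measurable_E[OF assms])
  note F = decreasing_rearrangement_measurable[OF x]
  have eq: "distribution_fun (decreasing_rearrangement x) s = distribution_fun x s" if "0 \<le> s" for s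
    by (rule distribution_fun_decreasing_rearrangement[OF x that])
  have "same_rearrangement (decreasing_rearrangement x) x"
    using same_rearrangement_iff[OF F x] eq by blast
  moreover have "integrable leb01 (decreasing_rearrangement x)"
    by (rule integrable_equimeasurable[OF F integrable[OF assms] eq])
  ultimately show "decreasing_rearrangement x \<in> E" "N (decreasing_rearrangement x) = N x"
    using assms rearrangement_mem rearrangement_norm by blast+
qed

text \<open>
  The hypothesis says that \<open>\<mu>(w) \<le> \<mu>(f)\<close> pointwise. As \<open>\<mu>(w)\<close> is equimeasurable with \<open>w\<close>,
  solidity applied to the rearrangements carries over to \<open>w\<close>.
\<close>

lemma distribution_le_imp_norm_le:
  assumes f: "f \<in> E" and w: "w \<in> borel_measurable leb01"
    and le: "\<And>s. 0 \<le> s \<Longrightarrow> distribution_fun w s \<le> distribution_fun f s"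
  shows "w \<in> E" "N w \<le> N f"
proof -
  let ?W = "decreasing_rearrangement w"
  note fm = measurable_E[OF f] and W = decreasing_rearrangement_measurable[OF w]
  have "?W t \<le> decreasing_rearrangement f t" if "0 < t" for t
    using decreasing_rearrangement_gt_iff[OF fm that, of "decreasing_rearrangement f t"]
      decreasing_rearrangement_gt_iff[OF w that, of "decreasing_rearrangement f t"]
      decreasing_rearrangement_nonneg[OF fm that] le[of "decreasing_rearrangement f t"]
    by fastforce
  then have *: "AE t in leb01. 0 \<le> ?W t \<and> ?W t \<le> decreasing_rearrangement f t"
    using decreasing_rearrangement_nonneg[OF w] by (intro AE_I2) auto
  have WE: "?W \<in> E"
    by (rule solid_mem[OF decreasing_rearrangement_mem(1)[OF f] W *])
  have eq: "distribution_fun w s = distribution_fun ?W s" if "0 \<le> s" for s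
    using distribution_fun_decreasing_rearrangement[OF w that] by simp
  have wi: "integrable leb01 w"
    by (rule integrable_equimeasurable[OF w integrable[OF WE] eq])
  have same: "same_rearrangement w ?W"
    using same_rearrangement_iff[OF w W] eq by blast
  show "w \<in> E" by (rule rearrangement_mem[OF WE wi same])
  have "N w = N ?W" by (rule rearrangement_norm[OF WE wi same])
  also have "\<dots> \<le> N (decreasing_rearrangement f)"
    by (rule solid_norm[OF decreasing_rearrangement_mem(1)[OF f] W *])
  finally show "N w \<le> N f" using decreasing_rearrangement_mem(2)[OF f] by simp
qed

lemma norm_mono:
  assumes "f \<in> E" "w \<in> borel_measurable leb01" "AE t in leb01. \<bar>w t\<bar> \<le> \<bar>f t\<bar>"
  shows "w \<in> E" "N w \<le> N f"
  using distribution_le_imp_norm_le[OF assms(1,2)] distribution_fun_mono[OF measurable_E[OF assms(1)] assms(3)]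
  by auto

lemma norm_zero: "N (\<lambda>t. 0) = 0"
  using norm_eq_zero_iff[OF zero_mem] by simp

lemma sum_mem_norm_le:
  assumes "finite I" "\<And>i. i \<in> I \<Longrightarrow> g i \<in> E"
  shows "(\<lambda>t. \<Sum>i\<in>I. g i t) \<in> E \<and> N (\<lambda>t. \<Sum>i\<in>I. g i t) \<le> (\<Sum>i\<in>I. N (g i))"
  using assms
proof (induction I rule: finite_induct)
  case empty
  then show ?case by (simp add: zero_mem norm_zero)
next
  case (insert i I)
  have "g i \<in> E" "(\<lambda>t. \<Sum>i\<in>I. g i t) \<in> E" using insert by auto
  from add_mem[OF this] norm_triangle[OF this] insert show ?case by auto
qed

text \<open>
  The interval \<open>(0,1)\<close> is cut into \<open>m\<close> pieces of length \<open>1/m\<close> and a copy of the part of \<open>\<mu>(f)\<close>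
  on \<open>(0,1/m)\<close> is put on each of them. Every copy has norm at most \<open>N f\<close>, and the sum of the
  copies has the distribution function \<open>min 1 (m d)\<close>, where \<open>d\<close> is that of \<open>f\<close>.
\<close>

lemma distribution_le_mult_imp_norm_le:
  assumes f: "f \<in> E" and w: "w \<in> borel_measurable leb01" and m: "0 < m"
    and le: "\<And>s. 0 \<le> s \<Longrightarrow> distribution_fun w s \<le> real m * distribution_fun f s"
  shows "w \<in> E" "N w \<le> real m * N f"
proof -
  interpret prob_space leb01 by (rule prob_space_leb01)
  note fm = measurable_E[OF f]
  define F where "F = decreasing_rearrangement f"
  define c where "c i = real i / m" for i
  define h where "h = 1 / real m"
  define I where "I i = {c i<..<c (Suc i)}" for i
  define g where "g i t = (if t \<in> I i then F (t - c i) else 0)" for i t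
  define d where "d s = min h (distribution_fun f s)" for s
  have d: "0 \<le> d s" "d s \<le> h" "d s \<le> distribution_fun f s" for s
    using distribution_fun_nonneg[of f s] by (auto simp: d_def h_def)
  have step: "c (Suc i) = c i + h" and c_nonneg: "0 \<le> c i" for i
    by (auto simp: c_def h_def add_divide_distrib)
  have c_mono: "c i \<le> c j" if "i \<le> j" for i j
    using that by (auto simp: c_def intro: divide_right_mono)
  have Fnn: "0 \<le> F t" if "0 < t" for t
    using decreasing_rearrangement_nonneg[OF fm that] by (simp add: F_def)
  have gnn: "0 \<le> g i t" for i t
    using Fnn by (simp add: g_def I_def)
  have c_le: "c i + h \<le> 1" if "i < m" for i
    unfolding step[symmetric] using that by (simp add: c_def divide_le_eq)
  have level: "{u \<in> {0<..<1}. \<bar>g i u\<bar> > s} = {0<..<1} \<inter> {c i<..<c i + d s}"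
    if "0 \<le> s" "i < m" for i s
  proof -
    have iff: "\<bar>g i u\<bar> > s \<longleftrightarrow> c i < u \<and> u < c i + d s" for u
    proof (cases "u \<in> I i")
      case True
      then have u: "0 < u - c i"
        unfolding I_def greaterThanLessThan_iff by linarith
      have iff: "\<bar>g i u\<bar> > s \<longleftrightarrow> u - c i < distribution_fun f s"
        using decreasing_rearrangement_gt_iff[OF fm u that(1)] True Fnn[OF u]
        unfolding g_def F_def by (simp only: if_True abs_of_nonneg)
      have u': "c i < u" "u < c i + h"
        using True unfolding I_def step greaterThanLessThan_iff by blast+
      have "u - c i < distribution_fun f s \<longleftrightarrow> u < c i + d s"
        using u'(2) unfolding d_def min_def by (cases "h \<le> distribution_fun f s") auto
      with iff u'(1) show ?thesis by blast
    next
      case False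
      then have "\<not> (c i < u \<and> u < c i + d s)"
        using d(2)[of s] unfolding I_def step greaterThanLessThan_iff by linarith
      moreover have "g i u = 0" unfolding g_def using False by (simp only: if_False)
      ultimately show ?thesis using that(1) by simp
    qed
    show ?thesis
      by (rule set_eqI) (simp only: iff mem_Collect_eq Int_iff greaterThanLessThan_iff)
  qed
  have level_measure: "measure leb01 ({0<..<1} \<inter> {c i<..<c i + d s}) = d s"
    and level_sets: "{0<..<1} \<inter> {c i<..<c i + d s} \<in> sets leb01"
    if "i < m" for i s
  proof -
    have b: "0 \<le> c i" "c i \<le> c i + d s" "c i + d s \<le> 1"
      using d[of s] c_nonneg[of i] c_le[OF that] by linarith+
    show "measure leb01 ({0<..<1} \<inter> {c i<..<c i + d s}) = d s"
      by (rule trans[OF measure_leb01_interval(1)[OF _ b]]) auto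
    show "{0<..<1} \<inter> {c i<..<c i + d s} \<in> sets leb01"
      by (rule measure_leb01_interval(2)[OF _ b]) simp
  qed
  have gm: "g i \<in> borel_measurable leb01" if "i < m" for i
  proof (rule borel_measurableI_greater)
    fix s
    show "{t \<in> space leb01. s < g i t} \<in> sets leb01"
    proof (cases "0 \<le> s")
      case True
      have "{t \<in> space leb01. s < g i t} = {u \<in> {0<..<1}. \<bar>g i u\<bar> > s}" using gnn by auto
      then show ?thesis using level_sets[OF that] level[OF True that] by simp
    next
      case False
      then have "{t \<in> space leb01. s < g i t} = space leb01"
        using gnn[of i] by (auto intro: less_le_trans[of s 0])
      then show ?thesis by simp
    qed
  qed
  have dg: "distribution_fun (g i) s = d s" if "i < m" "0 \<le> s" for i s
    unfolding distribution_fun_def level[OF that(2,1)] by (rule level_measure[OF that(1)])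
  have gE: "g i \<in> E" and gN: "N (g i) \<le> N f" if "i < m" for i
    using distribution_le_imp_norm_le[OF f gm[OF that]] dg[OF that] d by auto
  let ?G = "\<lambda>t. \<Sum>i<m. g i t"
  have G: "?G \<in> E \<and> N ?G \<le> (\<Sum>i<m. N (g i))"
    by (rule sum_mem_norm_le) (use gE in auto)
  then have GE: "?G \<in> E" by blast
  have "N ?G \<le> (\<Sum>i<m. N (g i))" using G by blast
  also have "\<dots> \<le> real m * N f"
    using sum_bounded_above[of "{..<m}" "\<lambda>i. N (g i)" "N f"] gN by simp
  finally have GN: "N ?G \<le> real m * N f" .
  have "distribution_fun w s \<le> distribution_fun ?G s" if s: "0 \<le> s" for s
  proof -
    let ?A = "\<lambda>i. {0<..<1} \<inter> {c i<..<c i + d s}"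
    have AI: "?A i \<subseteq> I i" for i 
    proof
      fix u assume "u \<in> ?A i"
      then show "u \<in> I i"
        using d(2)[of s] unfolding I_def step Int_iff greaterThanLessThan_iff by linarith
    qed
    have disj: "disjoint_family_on ?A {..<m}"
    proof -
      have "?A i \<inter> ?A j = {}" if "i < j" for i j
      proof -
        have "c (Suc i) \<le> c j" using that by (intro c_mono) auto
        then have "I i \<inter> I j = {}" by (auto simp: I_def)
        then show ?thesis using AI[of i] AI[of j] by blast
      qed
      then show ?thesis unfolding disjoint_family_on_def by (metis Int_commute nat_neq_iff)
    qed
    have "distribution_fun w s \<le> real m * d s"
      using le[OF s] distribution_fun_le_1[of w s] m by (auto simp: d_def h_def min_def)
    also have "\<dots> = (\<Sum>i<m. measure leb01 (?A i))"
      by (subst sum.cong[OF refl level_measure]) (auto simp only: lessThan_iff sum_constant card_lessThan)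
    also have "\<dots> = measure leb01 (\<Union>i<m. ?A i)"
      by (rule finite_measure_finite_Union[symmetric, OF finite_lessThan _ disj])
        (use level_sets in blast)
    also have "\<dots> \<le> distribution_fun ?G s"
      unfolding distribution_fun_def
    proof (rule finite_measure_mono)
      show "(\<Union>i<m. ?A i) \<subseteq> {u \<in> {0<..<1}. s < \<bar>?G u\<bar>}"
      proof
        fix u assume "u \<in> (\<Union>i<m. ?A i)"
        then obtain i where i: "i < m" "u \<in> ?A i" by blast
        then have "u \<in> {0<..<1}" "s < \<bar>g i u\<bar>" unfolding level[OF s i(1), symmetric] by blast+
        moreover have "\<bar>g i u\<bar> \<le> ?G u"
          using member_le_sum[of i "{..<m}" "\<lambda>i. g i u"] gnn i(1) by auto
        ultimately show "u \<in> {u \<in> {0<..<1}. s < \<bar>?G u\<bar>}" by auto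
      qed
    qed (rule superlevel_sets[OF measurable_E[OF GE]])
    finally show ?thesis .
  qed
  from distribution_le_imp_norm_le[OF GE w this] GN
  show "w \<in> E" "N w \<le> real m * N f" by auto
qed

section \<open>Dilations\<close>

lemma dilation_measurable:
  assumes "x \<in> E" "0 < m"
  shows "dilation m (decreasing_rearrangement x) \<in> borel_measurable leb01"
  using decreasing_rearrangement_antimono[OF measurable_E[OF assms(1)]] assms(2)
  by (intro borel_measurable_antimono01) (auto simp: dilation_def divide_right_mono)

lemma dilation_mem:
  assumes "x \<in> E" "0 < m"
  shows "dilation m (decreasing_rearrangement x) \<in> E"
proof (rule distribution_le_mult_imp_norm_le(1)[OF assms(1) dilation_measurable[OF assms] assms(2)])
  fix s :: real assume "0 \<le> s"
  then show "distribution_fun (dilation m (decreasing_rearrangement x)) s \<le> real m * distribution_fun x s"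
    by (simp add: distribution_fun_dilation[OF measurable_E[OF assms(1)] assms(2)])
qed

lemma norm_dilation_mult_le:
  assumes "x \<in> E" "0 < m" "0 < n"
  shows "N (dilation (m * n) (decreasing_rearrangement x)) \<le> real m * N (dilation n (decreasing_rearrangement x))"
proof (rule distribution_le_mult_imp_norm_le(2)[OF dilation_mem])
  fix s :: real assume s: "0 \<le> s"
  note d = distribution_fun_dilation[OF measurable_E[OF assms(1)] _ s]
  have "min 1 (real (m * n) * distribution_fun x s) \<le> real m * min 1 (real n * distribution_fun x s)"
  proof (cases "real n * distribution_fun x s \<le> 1")
    case True
    then have "min 1 (real n * distribution_fun x s) = real n * distribution_fun x s"
      by (rule min_absorb2)
    then show ?thesis by simp
  next
    case False
    then have "min 1 (real n * distribution_fun x s) = 1" by simp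
    moreover have "min 1 (real (m * n) * distribution_fun x s) \<le> 1" by (rule min.cobounded1)
    ultimately show ?thesis using assms(2) by simp
  qed
  then show "distribution_fun (dilation (m * n) (decreasing_rearrangement x)) s
      \<le> real m * distribution_fun (dilation n (decreasing_rearrangement x)) s"
    using assms by (simp add: d)
qed (use assms dilation_measurable[of x "m * n"] in auto)

lemma norm_dilation_mono:
  assumes "x \<in> E" "0 < m" "m \<le> n"
  shows "N (dilation m (decreasing_rearrangement x)) \<le> N (dilation n (decreasing_rearrangement x))"
proof (rule distribution_le_imp_norm_le(2)[OF dilation_mem])
  fix s :: real assume s: "0 \<le> s"
  note d = distribution_fun_dilation[OF measurable_E[OF assms(1)] _ s]
  have "real m * distribution_fun x s \<le> real n * distribution_fun x s"
    using assms distribution_fun_nonneg by (intro mult_right_mono) auto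
  then show "distribution_fun (dilation m (decreasing_rearrangement x)) s
      \<le> distribution_fun (dilation n (decreasing_rearrangement x)) s"
    using assms by (auto simp: d)
qed (use assms dilation_measurable[of x m] in auto)

end

text \<open>
  For every \<open>n\<close>, rounding \<open>m\<close> up to a multiple of \<open>n\<close> gives \<open>p m / m \<le> (1/n + 1/m) p n\<close>. Letting
  \<open>m\<close> tend to infinity bounds the limit superior by \<open>p n / n\<close>, so the limit is the infimum.
\<close>

lemma averages_converge:
  fixes p :: "nat \<Rightarrow> real"
  assumes nonneg: "\<And>m. 0 < m \<Longrightarrow> 0 \<le> p m"
    and mono: "\<And>m n. 0 < m \<Longrightarrow> m \<le> n \<Longrightarrow> p m \<le> p n"
    and mult: "\<And>m n. 0 < m \<Longrightarrow> 0 < n \<Longrightarrow> p (m * n) \<le> real m * p n"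
  shows "\<exists>L\<ge>0. (\<lambda>m. 1 / real m * p m) \<longlonglongrightarrow> L \<and> (\<forall>n>0. L \<le> p n / real n)"
proof -
  define L where "L = (INF n\<in>{0<..}. p n / real n)"
  have bdd: "bdd_below ((\<lambda>n. p n / real n) ` {0<..})"
    using nonneg by (intro bdd_belowI[of _ 0]) auto
  have L_le: "L \<le> p n / real n" if "0 < n" for n
    unfolding L_def using that by (intro cINF_lower[OF bdd]) auto
  have L0: "0 \<le> L" unfolding L_def using nonneg by (intro cINF_greatest) auto
  have upper: "p m / real m \<le> (1 / real n + 1 / real m) * p n" if "0 < m" "0 < n" for m n
  proof -
    have "m < n * Suc (m div n)" using that by (simp add: dividend_less_times_div)
    then have "p m \<le> p (Suc (m div n) * n)" using that by (intro mono) (auto simp: mult.commute)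
    also have "\<dots> \<le> real (Suc (m div n)) * p n" using that by (intro mult) auto
    also have "\<dots> \<le> (real m / real n + 1) * p n"
    proof (rule mult_right_mono)
      have "real (m div n * n) \<le> real m" by (simp only: of_nat_le_iff div_times_less_eq_dividend)
      then show "real (Suc (m div n)) \<le> real m / real n + 1" using that by (simp add: field_simps)
    qed (rule nonneg[OF that(2)])
    finally have "p m / real m \<le> (real m / real n + 1) * p n / real m"
      by (intro divide_right_mono) auto
    also have "\<dots> = (1 / real n + 1 / real m) * p n" using that by (simp add: field_simps)
    finally show ?thesis .
  qed
  have "(\<lambda>m. p m / real m) \<longlonglongrightarrow> L"
  proof (rule order_tendstoI)
    fix a assume "a < L"
    then show "eventually (\<lambda>m. a < p m / real m) sequentially"
      using L_le by (intro eventually_sequentiallyI[of 1]) (auto intro: less_le_trans)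
  next
    fix a assume "L < a"
    then obtain n where n: "0 < n" "p n / real n < a"
      unfolding L_def by (subst (asm) cINF_less_iff[OF _ bdd]) auto
    have "(\<lambda>m. (1 / real n + 1 / real m) * p n) \<longlonglongrightarrow> (1 / real n + 0) * p n"
      by (intro tendsto_intros lim_1_over_n)
    then have "eventually (\<lambda>m. (1 / real n + 1 / real m) * p n < a) sequentially"
      using n(2) by (intro order_tendstoD) auto
    then show "eventually (\<lambda>m. p m / real m < a) sequentially"
      using eventually_gt_at_top[of 0]
      by eventually_elim (use upper n(1) in \<open>auto intro: le_less_trans\<close>)
  qed
  then show ?thesis using L0 L_le by (intro exI[of _ L]) auto
qed

section \<open>Truncated integrals\<close>

lemma exists_linear_functional:
  fixes W :: "('a \<Rightarrow> real) set"
  assumes "(\<lambda>t. 0) \<in> W"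
    and "\<And>f g. f \<in> W \<Longrightarrow> g \<in> W \<Longrightarrow> (\<lambda>t. f t + g t) \<in> W"
    and "\<And>c f. f \<in> W \<Longrightarrow> (\<lambda>t. c * f t) \<in> W"
    and "w \<notin> W"
  shows "\<exists>\<phi>. (\<forall>f g. \<phi> (\<lambda>t. f t + g t) = \<phi> f + \<phi> g) \<and> (\<forall>c f. \<phi> (\<lambda>t. c * f t) = c * \<phi> f) \<and>
             (\<forall>f\<in>W. \<phi> f = 0) \<and> \<phi> w = (L::real)"
proof -
  interpret vector_space_pair "\<lambda>c (f :: 'a \<Rightarrow> real) t. c * f t" "(*) :: real \<Rightarrow> real \<Rightarrow> real"
    by unfold_locales (auto simp: plus_fun_def fun_eq_iff algebra_simps)
  have sub: "vs1.subspace W"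
    using assms by (auto simp: vs1.subspace_def plus_fun_def zero_fun_def)
  obtain B where B: "B \<subseteq> W" "vs1.independent B" "W \<subseteq> vs1.span B"
    by (rule vs1.maximal_independent_subset)
  have "vs1.span B \<subseteq> W" by (rule vs1.span_minimal[OF B(1) sub])
  with assms(4) have w: "w \<notin> vs1.span B" by blast
  then have wB: "w \<notin> B" using vs1.span_base by blast
  obtain \<phi> where lin: "Vector_Spaces.linear (\<lambda>c (f :: 'a \<Rightarrow> real) t. c * f t) (*) \<phi>"
    and \<phi>: "\<forall>b\<in>insert w B. \<phi> b = (if b = w then L else 0)"
    using linear_independent_extend[OF vs1.independent_insertI[OF w B(2)],
        of "\<lambda>b. if b = w then L else 0"] by blast
  interpret lin: Vector_Spaces.linear "\<lambda>c (f :: 'a \<Rightarrow> real) t. c * f t" "(*)" \<phi> by (rule lin)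
  have "\<phi> f = 0" if "f \<in> W" for f
  proof -
    have "f \<in> vs1.span B" using that B(3) by blast
    moreover have "\<phi> b = 0" if "b \<in> B" for b using \<phi> that wB by auto
    ultimately show ?thesis by (rule linear_eq_0_on_span[OF lin, rotated])
  qed
  then show ?thesis
    using lin.add lin.scale \<phi> by (intro exI[of _ \<phi>]) (auto simp: plus_fun_def)
qed

lemma truncated_measurable:
  fixes w g :: "real \<Rightarrow> real"
  assumes "w \<in> borel_measurable leb01" "g \<in> borel_measurable leb01"
  shows "(\<lambda>t. w t * indicator {t. g t > (r::real)} t) \<in> borel_measurable leb01"
proof -
  have [measurable]: "w \<in> borel_measurable leb01" "g \<in> borel_measurable leb01" by fact+
  have "(\<lambda>t. if g t > r then w t else (0::real)) \<in> borel_measurable leb01" by measurable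
  also have "(\<lambda>t. if g t > r then w t else 0) = (\<lambda>t. w t * indicator {t. g t > r} t)"
    by (auto simp: indicator_def)
  finally show ?thesis .
qed

lemma truncated_integrable:
  fixes w g :: "real \<Rightarrow> real"
  assumes "integrable leb01 w" "g \<in> borel_measurable leb01"
  shows "integrable leb01 (\<lambda>t. w t * indicator {t. g t > (r::real)} t :: real)"
  by (rule Bochner_Integration.integrable_bound[OF assms(1) truncated_measurable])
    (use assms in \<open>auto simp: indicator_def\<close>)

lemma integral_superlevel:
  assumes "g \<in> borel_measurable leb01" "AE t in leb01. 0 \<le> g t" "0 \<le> r"
  shows "(\<integral>t. indicator {t. g t > r} t \<partial>leb01) = distribution_fun g r"
    and "integrable leb01 (\<lambda>t. indicator {t. g t > r} t :: real)"
proof -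
  interpret prob_space leb01 by (rule prob_space_leb01)
  let ?A = "{u \<in> {0<..<1}. \<bar>g u\<bar> > r}"
  have A: "?A \<in> sets leb01" by (rule superlevel_sets[OF assms(1)])
  have *: "AE t in leb01. indicator {t. g t > r} t = (indicator ?A t :: real)"
    using assms(2) AE_space by eventually_elim (use assms(3) in \<open>auto simp: indicator_def\<close>)
  have m: "(\<lambda>t. indicator {t. g t > r} t :: real) \<in> borel_measurable leb01"
    using truncated_measurable[of "\<lambda>t. 1", OF _ assms(1), of r] by simp
  have "(\<integral>t. indicator {t. g t > r} t \<partial>leb01) = (\<integral>t. indicator ?A t \<partial>leb01 :: real)"
    by (rule integral_cong_AE[OF m borel_measurable_indicator[OF A] *])
  also have "\<dots> = measure leb01 (?A \<inter> space leb01)" by simp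
  also have "?A \<inter> space leb01 = ?A" by auto
  also have "measure leb01 \<dots> = distribution_fun g r" by (simp add: distribution_fun_def)
  finally show "(\<integral>t. indicator {t. g t > r} t \<partial>leb01) = distribution_fun g r" .
  show "integrable leb01 (\<lambda>t. indicator {t. g t > r} t :: real)"
    using truncated_integrable[of "\<lambda>t. 1", OF _ assms(1), of r] by simp
qed

text \<open>
  Enlarging the set \<open>{y > r}\<close> to \<open>{g > r}\<close> adds points where \<open>y\<close> is at most \<open>r\<close>.
\<close>

lemma integral_enlarged_superlevel:
  assumes y: "integrable leb01 y" and g: "g \<in> borel_measurable leb01"
    and yg: "AE t in leb01. 0 \<le> y t \<and> y t \<le> g t" and r: "0 \<le> r"
  shows "(\<integral>t. y t * indicator {t. y t > r} t \<partial>leb01) \<le> (\<integral>t. y t * indicator {t. g t > r} t \<partial>leb01)"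
    and "(\<integral>t. y t * indicator {t. g t > r} t \<partial>leb01) \<le>
         (\<integral>t. y t * indicator {t. y t > r} t \<partial>leb01) + r * distribution_fun g r"
proof -
  have ym: "y \<in> borel_measurable leb01" using y by auto
  have g0: "AE t in leb01. 0 \<le> g t" using yg by eventually_elim auto
  show "(\<integral>t. y t * indicator {t. y t > r} t \<partial>leb01) \<le> (\<integral>t. y t * indicator {t. g t > r} t \<partial>leb01)"
  proof (rule integral_mono_AE[OF truncated_integrable[OF y ym] truncated_integrable[OF y g]])
    show "AE t in leb01. y t * indicator {t. y t > r} t \<le> y t * indicator {t. g t > r} t"
      using yg by eventually_elim (auto simp: indicator_def)
  qed
  note i = truncated_integrable[OF y ym, of r] integral_superlevel(2)[OF g g0 r]
  have "(\<integral>t. y t * indicator {t. g t > r} t \<partial>leb01) \<le>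
        (\<integral>t. y t * indicator {t. y t > r} t + r * indicator {t. g t > r} t \<partial>leb01)"
  proof (rule integral_mono_AE[OF truncated_integrable[OF y g]])
    show "AE t in leb01. y t * indicator {t. g t > r} t \<le>
        y t * indicator {t. y t > r} t + r * indicator {t. g t > r} t"
      using yg by eventually_elim (use r in \<open>auto simp: indicator_def\<close>)
    show "integrable leb01 (\<lambda>t. y t * indicator {t. y t > r} t + r * indicator {t. g t > r} t)"
      using i by simp
  qed
  also have "\<dots> = (\<integral>t. y t * indicator {t. y t > r} t \<partial>leb01) + r * distribution_fun g r"
    using i integral_superlevel(1)[OF g g0 r] by simp
  finally show "(\<integral>t. y t * indicator {t. g t > r} t \<partial>leb01) \<le>
         (\<integral>t. y t * indicator {t. y t > r} t \<partial>leb01) + r * distribution_fun g r" .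
qed

context symmetric_banach_space
begin

text \<open>
  The bound is required for all \<open>g \<ge> h\<close>, and not just for \<open>g = h\<close>, to make the class closed under
  addition: for \<open>w\<^sub>1 + w\<^sub>2\<close> the dominating function \<open>h\<^sub>1 + h\<^sub>2\<close> lies above both \<open>h\<^sub>1\<close> and \<open>h\<^sub>2\<close>. The
  summand \<open>1\<close> in \<open>r + 1\<close> accommodates bounded functions.
\<close>

definition small_truncations :: "(real \<Rightarrow> real) set" where
  "small_truncations = {w \<in> E. \<exists>h\<in>E. \<exists>K\<ge>0. (AE t in leb01. 0 \<le> h t) \<and>
     (\<forall>g\<in>E. (AE t in leb01. h t \<le> g t) \<longrightarrow>
        (\<forall>r\<ge>0. \<bar>\<integral>t. w t * indicator {t. g t > r} t \<partial>leb01\<bar> \<le> K * (r + 1) * distribution_fun g r))}"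

lemma small_truncationsI:
  assumes "w \<in> E" "h \<in> E" "0 \<le> K" "AE t in leb01. 0 \<le> h t"
    and "\<And>g r. g \<in> E \<Longrightarrow> AE t in leb01. h t \<le> g t \<Longrightarrow> 0 \<le> r \<Longrightarrow>
      \<bar>\<integral>t. w t * indicator {t. g t > r} t \<partial>leb01\<bar> \<le> K * (r + 1) * distribution_fun g r"
  shows "w \<in> small_truncations"
  using assms unfolding small_truncations_def by blast

lemma small_truncationsE:
  assumes "w \<in> small_truncations"
  obtains h K where "w \<in> E" "h \<in> E" "0 \<le> K" "AE t in leb01. 0 \<le> h t"
    and "\<And>g r. g \<in> E \<Longrightarrow> AE t in leb01. h t \<le> g t \<Longrightarrow> 0 \<le> r \<Longrightarrow>
      \<bar>\<integral>t. w t * indicator {t. g t > r} t \<partial>leb01\<bar> \<le> K * (r + 1) * distribution_fun g r"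
  using assms unfolding small_truncations_def by blast

lemma small_truncations_zero: "(\<lambda>t. 0) \<in> small_truncations"
  by (rule small_truncationsI[OF zero_mem zero_mem, of 0]) auto

lemma small_truncations_scale:
  assumes "w \<in> small_truncations"
  shows "(\<lambda>t. c * w t) \<in> small_truncations"
proof -
  obtain h K where w: "w \<in> E" "h \<in> E" "0 \<le> K" "AE t in leb01. 0 \<le> h t"
    and le: "\<And>g r. g \<in> E \<Longrightarrow> AE t in leb01. h t \<le> g t \<Longrightarrow> 0 \<le> r \<Longrightarrow>
      \<bar>\<integral>t. w t * indicator {t. g t > r} t \<partial>leb01\<bar> \<le> K * (r + 1) * distribution_fun g r"
    using assms by (rule small_truncationsE) (rule that)
  show ?thesis
  proof (rule small_truncationsI[OF scale_mem[OF w(1)] w(2) _ w(4), of "\<bar>c\<bar> * K"])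
    fix g :: "real \<Rightarrow> real" and r :: real assume g: "g \<in> E" "AE t in leb01. h t \<le> g t" "0 \<le> r"
    have "(\<integral>t. c * w t * indicator {t. g t > r} t \<partial>leb01) = c * (\<integral>t. w t * indicator {t. g t > r} t \<partial>leb01)"
      by (simp add: mult.assoc)
    then show "\<bar>\<integral>t. c * w t * indicator {t. g t > r} t \<partial>leb01\<bar> \<le> \<bar>c\<bar> * K * (r + 1) * distribution_fun g r"
      using mult_left_mono[OF le[OF g], of "\<bar>c\<bar>"] by (simp add: abs_mult mult.assoc)
  qed (use w in auto)
qed

lemma small_truncations_add:
  assumes "w1 \<in> small_truncations" "w2 \<in> small_truncations"
  shows "(\<lambda>t. w1 t + w2 t) \<in> small_truncations"
proof -
  obtain h1 K1 where w1: "w1 \<in> E" "h1 \<in> E" "0 \<le> K1" "AE t in leb01. 0 \<le> h1 t"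
    and le1: "\<And>g r. g \<in> E \<Longrightarrow> AE t in leb01. h1 t \<le> g t \<Longrightarrow> 0 \<le> r \<Longrightarrow>
      \<bar>\<integral>t. w1 t * indicator {t. g t > r} t \<partial>leb01\<bar> \<le> K1 * (r + 1) * distribution_fun g r"
    using assms(1) by (rule small_truncationsE) (rule that)
  obtain h2 K2 where w2: "w2 \<in> E" "h2 \<in> E" "0 \<le> K2" "AE t in leb01. 0 \<le> h2 t"
    and le2: "\<And>g r. g \<in> E \<Longrightarrow> AE t in leb01. h2 t \<le> g t \<Longrightarrow> 0 \<le> r \<Longrightarrow>
      \<bar>\<integral>t. w2 t * indicator {t. g t > r} t \<partial>leb01\<bar> \<le> K2 * (r + 1) * distribution_fun g r"
    using assms(2) by (rule small_truncationsE) (rule that)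
  show ?thesis
  proof (rule small_truncationsI[OF add_mem[OF w1(1) w2(1)] add_mem[OF w1(2) w2(2)], of "K1 + K2"])
    show "AE t in leb01. 0 \<le> h1 t + h2 t" using w1(4) w2(4) by eventually_elim auto
    fix g :: "real \<Rightarrow> real" and r :: real
    assume g: "g \<in> E" "AE t in leb01. h1 t + h2 t \<le> g t" and r: "0 \<le> r"
    have g1: "AE t in leb01. h1 t \<le> g t" using g(2) w2(4) by eventually_elim auto
    have g2: "AE t in leb01. h2 t \<le> g t" using g(2) w1(4) by eventually_elim auto
    note i = truncated_integrable[OF integrable[OF w1(1)] measurable_E[OF g(1)], of r]
      truncated_integrable[OF integrable[OF w2(1)] measurable_E[OF g(1)], of r]
    have "(\<integral>t. (w1 t + w2 t) * indicator {t. g t > r} t \<partial>leb01) =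
      (\<integral>t. w1 t * indicator {t. g t > r} t \<partial>leb01) + (\<integral>t. w2 t * indicator {t. g t > r} t \<partial>leb01)"
      using i by (simp add: distrib_right)
    then show "\<bar>\<integral>t. (w1 t + w2 t) * indicator {t. g t > r} t \<partial>leb01\<bar> \<le> (K1 + K2) * (r + 1) * distribution_fun g r"
      using le1[OF g(1) g1 r] le2[OF g(1) g2 r] by (simp add: algebra_simps)
  qed (use w1 w2 in auto)
qed

lemma bounded_in_small_truncations:
  assumes b: "b \<in> E" and C: "AE t in leb01. \<bar>b t\<bar> \<le> C"
  shows "b \<in> small_truncations"
proof (rule small_truncationsI[OF b zero_mem, of "\<bar>C\<bar>"])
  fix g :: "real \<Rightarrow> real" and r :: real assume g: "g \<in> E" "AE t in leb01. 0 \<le> g t" and r: "0 \<le> r"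
  note gm = measurable_E[OF g(1)]
  note i = truncated_integrable[OF integrable[OF b] gm, of r] integral_superlevel(2)[OF gm g(2) r]
  have "\<bar>\<integral>t. b t * indicator {t. g t > r} t \<partial>leb01\<bar> \<le> (\<integral>t. \<bar>b t * indicator {t. g t > r} t\<bar> \<partial>leb01)"
    by (rule integral_abs_bound)
  also have "\<dots> \<le> (\<integral>t. \<bar>C\<bar> * indicator {t. g t > r} t \<partial>leb01)"
  proof (rule integral_mono_AE)
    show "AE t in leb01. \<bar>b t * indicator {t. g t > r} t\<bar> \<le> \<bar>C\<bar> * indicator {t. g t > r} t"
      using C by eventually_elim (auto simp: indicator_def)
  qed (use i in auto)
  also have "\<dots> = \<bar>C\<bar> * distribution_fun g r"
    using integral_superlevel(1)[OF gm g(2) r] by simp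
  also have "\<dots> \<le> \<bar>C\<bar> * (r + 1) * distribution_fun g r"
    using r distribution_fun_nonneg[of g r] by (intro mult_right_mono) (auto simp: algebra_simps)
  finally show "\<bar>\<integral>t. b t * indicator {t. g t > r} t \<partial>leb01\<bar> \<le> \<bar>C\<bar> * (r + 1) * distribution_fun g r" .
qed auto

text \<open>
  The integrals of \<open>y\<close> over \<open>{y > r}\<close> and of \<open>z\<close> over \<open>{z > r}\<close> agree, and passing to the common
  set \<open>{g > r}\<close> increases each of them by at most \<open>r d\<^sub>g(r)\<close>.
\<close>

lemma equimeasurable_diff_in_small_truncations:
  assumes y: "y \<in> E" and z: "z \<in> E" and y0: "AE t in leb01. 0 \<le> y t" and z0: "AE t in leb01. 0 \<le> z t"
    and yz: "same_rearrangement y z"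
  shows "(\<lambda>t. y t - z t) \<in> small_truncations"
proof (rule small_truncationsI[of _ "\<lambda>t. y t + z t" 1])
  have "(\<lambda>t. y t + (-1) * z t) \<in> E" by (intro add_mem scale_mem y z)
  then show "(\<lambda>t. y t - z t) \<in> E" by simp
  show "AE t in leb01. 0 \<le> y t + z t" using y0 z0 by eventually_elim auto
  fix g :: "real \<Rightarrow> real" and r :: real
  assume g: "g \<in> E" "AE t in leb01. y t + z t \<le> g t" and r: "0 \<le> r"
  note gm = measurable_E[OF g(1)]
  have yg: "AE t in leb01. 0 \<le> y t \<and> y t \<le> g t" using y0 z0 g(2) by eventually_elim auto
  have zg: "AE t in leb01. 0 \<le> z t \<and> z t \<le> g t" using y0 z0 g(2) by eventually_elim auto
  have eq: "(\<integral>t. y t * indicator {t. y t > r} t \<partial>leb01) = (\<integral>t. z t * indicator {t. z t > r} t \<partial>leb01)"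
    using yz same_rearrangement_iff measurable_E[OF y] measurable_E[OF z]
    by (intro integral_truncation_equimeasurable y0 z0) auto
  note i = truncated_integrable[OF integrable[OF y] gm, of r]
      truncated_integrable[OF integrable[OF z] gm, of r]
  have "(\<integral>t. (y t - z t) * indicator {t. g t > r} t \<partial>leb01) =
      (\<integral>t. y t * indicator {t. g t > r} t \<partial>leb01) - (\<integral>t. z t * indicator {t. g t > r} t \<partial>leb01)"
    using i by (simp add: left_diff_distrib)
  then show "\<bar>\<integral>t. (y t - z t) * indicator {t. g t > r} t \<partial>leb01\<bar> \<le> 1 * (r + 1) * distribution_fun g r"
    using integral_enlarged_superlevel[OF integrable[OF y] gm yg r]
      integral_enlarged_superlevel[OF integrable[OF z] gm zg r] eq distribution_fun_nonneg[of g r]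
    by (simp add: algebra_simps abs_le_iff)
qed (use y z add_mem in auto)

text \<open>
  With \<open>g = x + h\<close> the set \<open>{x > r}\<close> is contained in \<open>{g > r}\<close> up to a null set.
\<close>

lemma small_truncations_integral_le:
  assumes x: "x \<in> small_truncations" and x0: "AE t in leb01. 0 \<le> x t"
  obtains g K where "g \<in> E" "0 \<le> K"
    "\<And>r. 0 \<le> r \<Longrightarrow> (\<integral>t. x t * indicator {t. x t > r} t \<partial>leb01) \<le> K * (r + 1) * distribution_fun g r"
proof -
  obtain h K where w: "x \<in> E" "h \<in> E" "0 \<le> K" "AE t in leb01. 0 \<le> h t"
    and le: "\<And>g r. g \<in> E \<Longrightarrow> AE t in leb01. h t \<le> g t \<Longrightarrow> 0 \<le> r \<Longrightarrow>
      \<bar>\<integral>t. x t * indicator {t. g t > r} t \<partial>leb01\<bar> \<le> K * (r + 1) * distribution_fun g r"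
    using x by (rule small_truncationsE) (rule that)
  let ?g = "\<lambda>t. x t + h t"
  have g: "?g \<in> E" by (rule add_mem[OF w(1,2)])
  have hg: "AE t in leb01. h t \<le> ?g t" using x0 by eventually_elim auto
  have xg: "AE t in leb01. 0 \<le> x t \<and> x t \<le> ?g t" using x0 w(4) by eventually_elim auto
  show thesis
  proof (rule that[OF g w(3)])
    fix r :: real assume r: "0 \<le> r"
    show "(\<integral>t. x t * indicator {t. x t > r} t \<partial>leb01) \<le> K * (r + 1) * distribution_fun ?g r"
      using integral_enlarged_superlevel(1)[OF integrable[OF w(1)] measurable_E[OF g] xg r]
        le[OF g hg r] by linarith
  qed
qed

end

section \<open>Dyadic levels\<close>

definition dyadic_level :: "real \<Rightarrow> nat" where
  "dyadic_level t = (LEAST l. 1 / 2 ^ Suc l \<le> t)"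

text \<open>
  The level \<open>[1/2^(l+1), 1/2^l)\<close> is divided into \<open>R\<close> cells of equal length, numbered from \<open>0\<close>.
\<close>

definition dyadic_cell :: "nat \<Rightarrow> real \<Rightarrow> nat" where
  "dyadic_cell R t = nat \<lfloor>(2 ^ Suc (dyadic_level t) * t - 1) * real R\<rfloor>"

definition dyadic_step :: "(nat \<Rightarrow> real) \<Rightarrow> real \<Rightarrow> real" where
  "dyadic_step v t = v (dyadic_level t)"

definition cell_fun :: "nat \<Rightarrow> (nat \<Rightarrow> nat \<Rightarrow> real) \<Rightarrow> real \<Rightarrow> real" where
  "cell_fun R A t = A (dyadic_level t) (dyadic_cell R t)"

lemma dyadic_level_iff:
  assumes "0 < t" "t < 1"
  shows "dyadic_level t = l \<longleftrightarrow> 1 / 2 ^ Suc l \<le> t \<and> t < 1 / 2 ^ l"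
proof -
  obtain k where "(1 / 2) ^ k < t" using real_arch_pow_inv[of t "1 / 2"] assms by auto
  then have "1 / 2 ^ k < t" by (simp add: power_one_over)
  moreover have "1 / 2 ^ Suc k \<le> (1 / 2 ^ k :: real)" by (simp add: field_simps)
  ultimately have ex: "1 / 2 ^ Suc k \<le> t" by linarith
  have lower: "1 / 2 ^ Suc (dyadic_level t) \<le> t"
    unfolding dyadic_level_def using ex by (rule LeastI)
  have upper: "t < 1 / 2 ^ dyadic_level t"
  proof (cases "dyadic_level t")
    case 0
    then show ?thesis using assms by simp
  next
    case (Suc m)
    then have "\<not> 1 / 2 ^ Suc m \<le> t"
      using not_less_Least[of m "\<lambda>l. 1 / 2 ^ Suc l \<le> t"] by (simp add: dyadic_level_def)
    with Suc show ?thesis by simp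
  qed
  show ?thesis
  proof
    assume "dyadic_level t = l"
    then show "1 / 2 ^ Suc l \<le> t \<and> t < 1 / 2 ^ l" using lower upper by blast
  next
    assume *: "1 / 2 ^ Suc l \<le> t \<and> t < 1 / 2 ^ l"
    then have "1 / 2 ^ Suc l < (1 / 2 ^ dyadic_level t :: real)" "1 / 2 ^ Suc (dyadic_level t) < (1 / 2 ^ l :: real)"
      using lower upper by linarith+
    then have "(2::real) ^ dyadic_level t < 2 ^ Suc l" "(2::real) ^ l < 2 ^ Suc (dyadic_level t)"
      by (auto simp: field_simps simp del: power_Suc)
    then have "dyadic_level t < Suc l" "l < Suc (dyadic_level t)"
      by (simp_all only: power_strict_increasing_iff one_less_numeral_iff semiring_norm)
    then show "dyadic_level t = l" by simp
  qed
qed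

lemma dyadic_cell_iff:
  assumes t: "0 < t" "t < 1" and q: "q < R"
  shows "dyadic_level t = j \<and> dyadic_cell R t = q \<longleftrightarrow>
    (1 + real q / R) / 2 ^ Suc j \<le> t \<and> t < (1 + real (Suc q) / R) / 2 ^ Suc j" (is "?L \<longleftrightarrow> ?R")
proof -
  have R: "0 < real R" using q by simp
  define p :: real where "p = 2 ^ Suc j"
  have p: "0 < p" by (simp add: p_def)
  have pj: "1 / 2 ^ j = 2 / p" by (simp add: p_def)
  have cell: "?R \<longleftrightarrow> real q \<le> (p * t - 1) * R \<and> (p * t - 1) * R < real q + 1"
    using R p unfolding p_def[symmetric] by (simp add: field_simps)
  have level: "dyadic_level t = j \<longleftrightarrow> 0 \<le> (p * t - 1) * R \<and> (p * t - 1) * R < R"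
    unfolding dyadic_level_iff[OF t] pj p_def[symmetric] using R p by (simp add: field_simps)
  have floor: "nat \<lfloor>y\<rfloor> = q \<longleftrightarrow> real q \<le> y \<and> y < real q + 1" if "0 \<le> y" for y :: real
  proof -
    have "nat \<lfloor>y\<rfloor> = q \<longleftrightarrow> \<lfloor>y\<rfloor> = int q" using that by auto
    also have "\<dots> \<longleftrightarrow> real q \<le> y \<and> y < real q + 1" by (simp add: floor_eq_iff)
    finally show ?thesis .
  qed
  show ?thesis
  proof
    assume L: ?L
    then have "0 \<le> (p * t - 1) * R" using level by blast
    moreover have "nat \<lfloor>(p * t - 1) * real R\<rfloor> = q" using L by (auto simp: dyadic_cell_def p_def)
    ultimately show ?R unfolding cell using floor by blast
  next
    assume ?R
    then have r: "real q \<le> (p * t - 1) * R" "(p * t - 1) * R < real q + 1" unfolding cell by auto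
    have "real q + 1 \<le> R" using q by linarith
    with r have "0 \<le> (p * t - 1) * R" "(p * t - 1) * R < R" by linarith+
    with level have j: "dyadic_level t = j" by blast
    with floor[OF \<open>0 \<le> (p * t - 1) * R\<close>] r show ?L by (simp add: dyadic_cell_def p_def)
  qed
qed

lemma dyadic_cell_less:
  assumes t: "0 < t" "t < 1" and "0 < R"
  shows "dyadic_cell R t < R"
proof -
  define p :: real where "p = 2 ^ Suc (dyadic_level t)"
  have "t < 1 / 2 ^ dyadic_level t" "1 / p \<le> t"
    using dyadic_level_iff[OF t, of "dyadic_level t"] unfolding p_def by auto
  then have "p * t - 1 < 1" "0 \<le> p * t - 1" by (auto simp: p_def field_simps)
  with assms have "(p * t - 1) * real R < real R" by simp
  then have "\<lfloor>(p * t - 1) * real R\<rfloor> < int R"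
    by (simp only: floor_less_iff of_int_of_nat_eq)
  then have "nat \<lfloor>(p * t - 1) * real R\<rfloor> < R" using assms(3) by linarith
  then show ?thesis unfolding dyadic_cell_def p_def .
qed

lemma measure_cell:
  assumes q: "q < R"
  shows "{t \<in> {0<..<1}. dyadic_level t = j \<and> dyadic_cell R t = q} \<in> sets leb01"
    and "measure leb01 {t \<in> {0<..<1}. dyadic_level t = j \<and> dyadic_cell R t = q} = 1 / (real R * 2 ^ Suc j)"
proof -
  define p :: real where "p = 2 ^ Suc j"
  have p: "2 \<le> p" by (simp add: p_def)
  have R: "0 < real R" "real q + 1 \<le> real R" using q by linarith+
  have eq: "{t \<in> {0<..<1}. dyadic_level t = j \<and> dyadic_cell R t = q} =
    {0<..<1} \<inter> {(1 + real q / R) / p..<(1 + real (Suc q) / R) / p}"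
    by (rule set_eqI)
      (use dyadic_cell_iff[OF _ _ q] in \<open>simp only: mem_Collect_eq Int_iff greaterThanLessThan_iff
        atLeastLessThan_iff p_def cong: conj_cong\<close>)
  have le1: "real (Suc q) / R \<le> 1" using R by simp
  have b: "0 \<le> (1 + real q / R) / p" "(1 + real q / R) / p \<le> (1 + real (Suc q) / R) / p"
    "(1 + real (Suc q) / R) / p \<le> 1"
  proof -
    show "0 \<le> (1 + real q / R) / p" using p by simp
    show "(1 + real q / R) / p \<le> (1 + real (Suc q) / R) / p"
      using p R by (intro divide_right_mono add_left_mono) auto
    have "(1 + real (Suc q) / R) \<le> p" using le1 p by linarith
    then show "(1 + real (Suc q) / R) / p \<le> 1" using p by (simp only: divide_le_eq_1) auto
  qed
  show "{t \<in> {0<..<1}. dyadic_level t = j \<and> dyadic_cell R t = q} \<in> sets leb01"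
    unfolding eq by (rule measure_leb01_interval(2)[OF _ b]) simp
  have "measure leb01 {t \<in> {0<..<1}. dyadic_level t = j \<and> dyadic_cell R t = q} =
      (1 + real (Suc q) / R) / p - (1 + real q / R) / p"
    unfolding eq by (rule measure_leb01_interval(1)[OF _ b]) simp
  also have "\<dots> = 1 / (real R * p)"
    using p R by (simp add: diff_divide_distrib[symmetric])
  finally show "measure leb01 {t \<in> {0<..<1}. dyadic_level t = j \<and> dyadic_cell R t = q} = 1 / (real R * 2 ^ Suc j)"
    by (simp add: p_def)
qed

text \<open>
  All cells of one level have the same length, so that a union of them is measured by counting.
\<close>

lemma measure_cells_on_level:
  assumes R: "0 < R"
  shows "{t \<in> {0<..<1}. dyadic_level t = j \<and> P (dyadic_cell R t)} \<in> sets leb01"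
    and "measure leb01 {t \<in> {0<..<1}. dyadic_level t = j \<and> P (dyadic_cell R t)} =
         real (card {q. q < R \<and> P q}) / (real R * 2 ^ Suc j)"
proof -
  interpret prob_space leb01 by (rule prob_space_leb01)
  let ?C = "\<lambda>q. {t \<in> {0<..<1}. dyadic_level t = j \<and> dyadic_cell R t = q}"
  have fin: "finite {q. q < R \<and> P q}" by simp
  have eq: "{t \<in> {0<..<1}. dyadic_level t = j \<and> P (dyadic_cell R t)} = (\<Union>q\<in>{q. q < R \<and> P q}. ?C q)"
    using dyadic_cell_less[OF _ _ R] by auto
  have s: "?C ` {q. q < R \<and> P q} \<subseteq> sets leb01" using measure_cell(1) by blast
  show "{t \<in> {0<..<1}. dyadic_level t = j \<and> P (dyadic_cell R t)} \<in> sets leb01"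
    unfolding eq using s fin by (intro sets.finite_UN) blast+
  have "measure leb01 (\<Union>q\<in>{q. q < R \<and> P q}. ?C q) = (\<Sum>q\<in>{q. q < R \<and> P q}. measure leb01 (?C q))"
    by (rule finite_measure_finite_Union[OF fin s]) (auto simp: disjoint_family_on_def)
  also have "\<dots> = (\<Sum>q\<in>{q. q < R \<and> P q}. 1 / (real R * 2 ^ Suc j))"
    by (rule sum.cong[OF refl]) (use measure_cell(2) in blast)
  finally show "measure leb01 {t \<in> {0<..<1}. dyadic_level t = j \<and> P (dyadic_cell R t)} =
         real (card {q. q < R \<and> P q}) / (real R * 2 ^ Suc j)"
    unfolding eq by simp
qed

lemma measure_cells:
  assumes R: "0 < R"
  shows "{t \<in> {0<..<1}. P (dyadic_level t) (dyadic_cell R t)} \<in> sets leb01"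
    and "(\<lambda>j. real (card {q. q < R \<and> P j q}) / (real R * 2 ^ Suc j)) sums
         measure leb01 {t \<in> {0<..<1}. P (dyadic_level t) (dyadic_cell R t)}"
proof -
  interpret prob_space leb01 by (rule prob_space_leb01)
  let ?C = "\<lambda>j. {t \<in> {0<..<1}. dyadic_level t = j \<and> P j (dyadic_cell R t)}"
  have eq: "{t \<in> {0<..<1}. P (dyadic_level t) (dyadic_cell R t)} = (\<Union>j. ?C j)" by auto
  have s: "range ?C \<subseteq> sets leb01" using measure_cells_on_level(1)[OF R] by blast
  show "{t \<in> {0<..<1}. P (dyadic_level t) (dyadic_cell R t)} \<in> sets leb01"
    unfolding eq using s by blast
  have "(\<lambda>j. measure leb01 (?C j)) sums measure leb01 (\<Union>j. ?C j)"
    by (rule finite_measure_UNION[OF s]) (auto simp: disjoint_family_on_def)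
  then show "(\<lambda>j. real (card {q. q < R \<and> P j q}) / (real R * 2 ^ Suc j)) sums
         measure leb01 {t \<in> {0<..<1}. P (dyadic_level t) (dyadic_cell R t)}"
    unfolding eq measure_cells_on_level(2)[OF R] .
qed

lemma cell_fun_measurable:
  assumes "0 < R"
  shows "cell_fun R A \<in> borel_measurable leb01"
proof (rule borel_measurableI_greater)
  fix s
  show "{t \<in> space leb01. s < cell_fun R A t} \<in> sets leb01"
    using measure_cells(1)[OF assms, of "\<lambda>j q. s < A j q"] by (simp add: cell_fun_def)
qed

lemma distribution_fun_cell_fun:
  assumes "0 < R"
  shows "(\<lambda>j. real (card {q. q < R \<and> \<bar>A j q\<bar> > s}) / (real R * 2 ^ Suc j)) sums distribution_fun (cell_fun R A) s"
  unfolding distribution_fun_def cell_fun_def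
  using measure_cells(2)[OF assms, of "\<lambda>j q. s < \<bar>A j q\<bar>"] by simp

lemma dyadic_step_eq_cell_fun: "dyadic_step v = cell_fun 1 (\<lambda>j q. v j)"
  by (auto simp: dyadic_step_def cell_fun_def)

lemma dyadic_step_measurable: "dyadic_step v \<in> borel_measurable leb01"
  unfolding dyadic_step_eq_cell_fun by (rule cell_fun_measurable) simp

lemma bij_betw_cyclic_shift:
  fixes R r :: nat
  shows "bij_betw (\<lambda>q. (q + r) mod R) {..<R} {..<R}"
proof (cases "R = 0")
  case False
  have inj: "inj_on (\<lambda>q. (q + r) mod R) {..<R}"
  proof (rule inj_onI)
    fix p q assume "p \<in> {..<R}" "q \<in> {..<R}" and eq: "(p + r) mod R = (q + r) mod R"
    have inverse: "((k + r) mod R + r * (R - 1)) mod R = k mod R" for k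
    proof -
      have "((k + r) mod R + r * (R - 1)) mod R = (k + r + r * (R - 1)) mod R" by (simp add: mod_add_left_eq)
      also have "k + r + r * (R - 1) = k + r * R" using False by (cases R) auto
      finally show ?thesis by simp
    qed
    then show "p = q" using inverse[of p] inverse[of q] eq \<open>p \<in> {..<R}\<close> \<open>q \<in> {..<R}\<close> by simp
  qed
  moreover have "(\<lambda>q. (q + r) mod R) ` {..<R} \<subseteq> {..<R}" using False by auto
  ultimately show ?thesis by (simp add: bij_betw_def endo_inj_surj)
qed (auto simp: bij_betw_def)

context symmetric_banach_space
begin

text \<open>
  Averaging over all cyclic shifts of the cells of each level replaces the values on a level
  by their mean. A shift does not change the distribution function.
\<close>

lemma norm_level_average_le:
  assumes R: "0 < R" and w: "cell_fun R A \<in> E"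
  shows "dyadic_step (\<lambda>j. (\<Sum>q<R. A j q) / R) \<in> E"
    and "N (dyadic_step (\<lambda>j. (\<Sum>q<R. A j q) / R)) \<le> N (cell_fun R A)"
proof -
  define W where "W r = cell_fun R (\<lambda>j q. A j ((q + r) mod R))" for r
  have "distribution_fun (W r) s = distribution_fun (cell_fun R A) s" for r s
  proof -
    have "card {q. q < R \<and> \<bar>A j ((q + r) mod R)\<bar> > s} = card {q. q < R \<and> \<bar>A j q\<bar> > s}" for j
    proof (rule bij_betw_same_card)
      show "bij_betw (\<lambda>q. (q + r) mod R) {q. q < R \<and> \<bar>A j ((q + r) mod R)\<bar> > s} {q. q < R \<and> \<bar>A j q\<bar> > s}"
      proof -
        have b: "bij_betw (\<lambda>q. (q + r) mod R) {..<R} {..<R}" by (rule bij_betw_cyclic_shift)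
        have "(\<lambda>q. (q + r) mod R) ` {q. q < R \<and> \<bar>A j ((q + r) mod R)\<bar> > s} = {q. q < R \<and> \<bar>A j q\<bar> > s}"
        proof (intro equalityI subsetI)
          fix y assume y: "y \<in> {q. q < R \<and> \<bar>A j q\<bar> > s}"
          then have "y \<in> (\<lambda>q. (q + r) mod R) ` {..<R}" using b by (auto simp: bij_betw_def)
          then obtain q where "q < R" "y = (q + r) mod R" by auto
          with y show "y \<in> (\<lambda>q. (q + r) mod R) ` {q. q < R \<and> \<bar>A j ((q + r) mod R)\<bar> > s}" by blast
        qed (use R in auto)
        moreover have "inj_on (\<lambda>q. (q + r) mod R) {q. q < R \<and> \<bar>A j ((q + r) mod R)\<bar> > s}"
          using b by (auto simp: bij_betw_def intro: inj_on_subset)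
        ultimately show ?thesis by (simp add: bij_betw_def)
      qed
    qed
    then show ?thesis
      using distribution_fun_cell_fun[OF R, where A = "\<lambda>j q. A j ((q + r) mod R)" and s = s]
        distribution_fun_cell_fun[OF R, where A = A and s = s] unfolding W_def by (simp add: sums_unique2)
  qed
  then have W: "W r \<in> E" "N (W r) \<le> N (cell_fun R A)" for r
    using distribution_le_imp_norm_le[OF w, of "W r"] cell_fun_measurable[OF R] unfolding W_def by auto
  have sum: "(\<Sum>r<R. W r t) = (\<Sum>q<R. A (dyadic_level t) q)" for t
  proof -
    have "(\<Sum>r<R. W r t) = (\<Sum>r<R. A (dyadic_level t) ((r + dyadic_cell R t) mod R))"
      by (simp add: W_def cell_fun_def add.commute)
    also have "\<dots> = (\<Sum>q<R. A (dyadic_level t) q)"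
      by (rule sum.reindex_bij_betw[OF bij_betw_cyclic_shift])
    finally show ?thesis .
  qed
  have eq: "dyadic_step (\<lambda>j. (\<Sum>q<R. A j q) / R) = (\<lambda>t. 1 / R * (\<Sum>r<R. W r t))"
    by (auto simp: sum dyadic_step_def)
  have S: "(\<lambda>t. \<Sum>r<R. W r t) \<in> E \<and> N (\<lambda>t. \<Sum>r<R. W r t) \<le> (\<Sum>r<R. N (W r))"
    by (rule sum_mem_norm_le) (use W in auto)
  then show "dyadic_step (\<lambda>j. (\<Sum>q<R. A j q) / R) \<in> E"
    unfolding eq by (intro scale_mem) blast
  have "N (dyadic_step (\<lambda>j. (\<Sum>q<R. A j q) / R)) = 1 / R * N (\<lambda>t. \<Sum>r<R. W r t)"
    unfolding eq using S by (subst norm_scale) auto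
  also have "\<dots> \<le> 1 / R * (\<Sum>r<R. N (W r))" using S by (intro mult_left_mono) auto
  also have "\<dots> \<le> 1 / R * (real R * N (cell_fun R A))"
    using sum_bounded_above[of "{..<R}" "\<lambda>r. N (W r)" "N (cell_fun R A)"] W by (intro mult_left_mono) auto
  also have "\<dots> = N (cell_fun R A)" using R by simp
  finally show "N (dyadic_step (\<lambda>j. (\<Sum>q<R. A j q) / R)) \<le> N (cell_fun R A)" .
qed

end

section \<open>Dyadic sums of rearrangements\<close>

context symmetric_banach_space
begin

text \<open>
  Let \<open>\<tau> = 1/2^l\<close> and \<open>r = \<mu>(\<tau>,g)\<close>, so that \<open>d\<^sub>g(r) \<le> \<tau>\<close>. On \<open>(0,\<tau>)\<close> the rearrangement \<open>F\<close> of \<open>x\<close>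
  is at most \<open>r\<close> outside \<open>{F > r}\<close>, and the integral of \<open>F\<close> over \<open>{F > r}\<close> is that of \<open>x\<close> over
  \<open>{x > r}\<close>. Hence the integral of \<open>F\<close> over \<open>(0,\<tau>)\<close> is at most \<open>(K (r + 1) + r) \<tau>\<close>, and the sum on
  the left is at most twice this integral.
\<close>

lemma dyadic_sum_le:
  assumes x: "x \<in> small_truncations" and x0: "AE t in leb01. 0 \<le> x t"
  obtains g K where "g \<in> E" "0 \<le> K"
    "\<And>l n. (\<Sum>i=l..l+n. decreasing_rearrangement x (1 / 2 ^ i) / 2 ^ i) \<le>
       (2 * (K + 1) * decreasing_rearrangement g (1 / 2 ^ l) + 2 * K) / 2 ^ l"
proof -
  interpret prob_space leb01 by (rule prob_space_leb01)
  obtain g K where g: "g \<in> E" "0 \<le> K" and le: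
    "\<And>r. 0 \<le> r \<Longrightarrow> (\<integral>t. x t * indicator {t. x t > r} t \<partial>leb01) \<le> K * (r + 1) * distribution_fun g r"
    using small_truncations_integral_le[OF assms] by blast
  have xE: "x \<in> E" using x by (simp add: small_truncations_def)
  note xm = measurable_E[OF xE] and gm = measurable_E[OF g(1)]
  define F where "F = decreasing_rearrangement x"
  have FE: "F \<in> E" unfolding F_def by (rule decreasing_rearrangement_mem(1)[OF xE])
  note Fm = measurable_E[OF FE]
  have Fnn: "0 \<le> F t" if "0 < t" for t
    unfolding F_def by (rule decreasing_rearrangement_nonneg[OF xm that])
  have F0: "AE t in leb01. 0 \<le> F t" by (rule AE_I2) (use Fnn in auto)
  have "(\<Sum>i=l..l+n. F (1 / 2 ^ i) / 2 ^ i) \<le>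
       (2 * (K + 1) * decreasing_rearrangement g (1 / 2 ^ l) + 2 * K) / 2 ^ l" for l n
  proof -
    define \<tau> :: real where "\<tau> = 1 / 2 ^ l"
    have \<tau>: "0 < \<tau>" "\<tau> \<le> 1" by (auto simp: \<tau>_def)
    define r where "r = decreasing_rearrangement g \<tau>"
    have r: "0 \<le> r" unfolding r_def by (rule decreasing_rearrangement_nonneg[OF gm \<tau>(1)])
    define J where "J i = {t \<in> {0<..<1}. dyadic_level t = i}" for i
    have J: "J i \<in> sets leb01" "measure leb01 (J i) = 1 / 2 ^ Suc i" for i
      using measure_cells_on_level[of 1 i "\<lambda>_. True"] by (simp_all add: J_def)
    have J01: "J i \<inter> {0<..<1} = J i" for i unfolding J_def by blast
    define T where "T = {0<..<1} \<inter> {0<..<\<tau>}"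
    have T: "T \<in> sets leb01" "measure leb01 T = \<tau>"
    proof -
      have b: "0 \<le> (0::real)" "0 \<le> \<tau>" "\<tau> \<le> 1" using \<tau> by auto
      show "T \<in> sets leb01" unfolding T_def by (rule measure_leb01_interval(2)[OF _ b]) simp
      show "measure leb01 T = \<tau>" unfolding T_def
        by (rule trans[OF measure_leb01_interval(1)[OF _ b]]) auto
    qed
    have T01: "T \<inter> {0<..<1} = T" unfolding T_def by blast
    have iJ: "integrable leb01 (\<lambda>t. F (1 / 2 ^ i) * indicator (J i) t)" for i
      using J by (intro integrable_mult_right integrable_real_indicator) (auto simp: emeasure_eq_measure)
    have "(\<Sum>i=l..l+n. F (1 / 2 ^ i) / 2 ^ i) = 2 * (\<Sum>i=l..l+n. F (1 / 2 ^ i) * measure leb01 (J i))"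
      by (simp add: J sum_distrib_left)
    also have "(\<Sum>i=l..l+n. F (1 / 2 ^ i) * measure leb01 (J i)) =
        (\<integral>t. (\<Sum>i=l..l+n. F (1 / 2 ^ i) * indicator (J i) t) \<partial>leb01)"
      using iJ by (subst Bochner_Integration.integral_sum) (auto simp: J01)
    also have "\<dots> \<le> (\<integral>t. F t * indicator {t. F t > r} t + r * indicator T t \<partial>leb01)"
    proof (rule integral_mono_AE)
      show "integrable leb01 (\<lambda>t. \<Sum>i=l..l+n. F (1 / 2 ^ i) * indicator (J i) t)"
        by (intro Bochner_Integration.integrable_sum iJ)
      show "integrable leb01 (\<lambda>t. F t * indicator {t. F t > r} t + r * indicator T t)"
        using truncated_integrable[OF integrable[OF FE] Fm, of r] T(1)
        by (intro Bochner_Integration.integrable_add integrable_mult_right integrable_real_indicator)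
           (auto simp: emeasure_eq_measure)
      have "(\<Sum>i=l..l+n. F (1 / 2 ^ i) * indicator (J i) t) \<le> F t * indicator T t" if t: "t \<in> {0<..<1}" for t
      proof -
        have ind: "indicator (J i) t = (if i = dyadic_level t then 1 else 0 :: real)" for i
          using t by (simp add: J_def indicator_def)
        have sum: "(\<Sum>i=l..l+n. F (1 / 2 ^ i) * indicator (J i) t) =
            (if dyadic_level t \<in> {l..l+n} then F (1 / 2 ^ dyadic_level t) else 0)"
          unfolding ind by (simp add: if_distrib[of "\<lambda>u. _ * u"] cong: if_cong)
        show ?thesis
        proof (cases "dyadic_level t \<in> {l..l+n}")
          case True
          have t': "t < 1 / 2 ^ dyadic_level t"
            using dyadic_level_iff[of t "dyadic_level t"] t by simp
          then have "F (1 / 2 ^ dyadic_level t) \<le> F t"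
            unfolding F_def using t by (intro decreasing_rearrangement_antimono[OF xm]) auto
          moreover have "1 / 2 ^ dyadic_level t \<le> \<tau>"
            unfolding \<tau>_def using True by (intro divide_left_mono power_increasing) auto
          with t' t have "t \<in> T"
            unfolding T_def Int_iff greaterThanLessThan_iff by linarith
          then have "indicator T t = (1 :: real)" by (rule indicator_simps(1))
          ultimately show ?thesis unfolding sum using True by (simp only: if_True mult_1_right)
        next
          case False
          have "0 \<le> F t" using Fnn[of t] t by (simp only: greaterThanLessThan_iff)
          with False show ?thesis unfolding sum by (simp only: if_False) (simp add: indicator_def)
        qed
      qed
      moreover have "F t * indicator T t \<le> F t * indicator {t. F t > r} t + r * indicator T t" if "t \<in> {0<..<1}" for t
        using Fnn[of t] that r by (auto simp: indicator_def)
      ultimately show "AE t in leb01. (\<Sum>i=l..l+n. F (1 / 2 ^ i) * indicator (J i) t)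
          \<le> F t * indicator {t. F t > r} t + r * indicator T t"
        by (intro AE_I2) (force simp only: space_lebesgue_on intro: order_trans)
    qed
    also have "\<dots> = (\<integral>t. F t * indicator {t. F t > r} t \<partial>leb01) + r * \<tau>"
      using truncated_integrable[OF integrable[OF FE] Fm, of r] T
      by (subst Bochner_Integration.integral_add) (auto simp: emeasure_eq_measure T01)
    also have "(\<integral>t. F t * indicator {t. F t > r} t \<partial>leb01) = (\<integral>t. x t * indicator {t. x t > r} t \<partial>leb01)"
      by (rule integral_truncation_equimeasurable[OF Fm xm F0 x0])
        (simp add: F_def distribution_fun_decreasing_rearrangement[OF xm])
    also have "\<dots> \<le> K * (r + 1) * distribution_fun g r" by (rule le[OF r])
    also have "\<dots> \<le> K * (r + 1) * \<tau>"
      using distribution_fun_decreasing_rearrangement_le[OF gm \<tau>(1)] g(2) r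
      unfolding r_def[symmetric] by (intro mult_left_mono) auto
    finally have "(\<Sum>i=l..l+n. F (1 / 2 ^ i) / 2 ^ i) \<le> 2 * (K * (r + 1) * \<tau> + r * \<tau>)" by simp
    also have "\<dots> = (2 * (K + 1) * r + 2 * K) / 2 ^ l" by (simp add: \<tau>_def field_simps)
    finally show ?thesis unfolding r_def \<tau>_def .
  qed
  then show thesis using that[OF g] unfolding F_def by blast
qed

end

section \<open>Moving mass to coarser dyadic levels\<close>

text \<open>
  A word over the letters \<open>j, ..., j + n\<close> with prescribed multiplicities. Its letter at position \<open>q\<close>
  will be the level from which cell \<open>q\<close> of level \<open>j\<close> takes its value; positions beyond the end of
  the word stand for the value \<open>0\<close>.
\<close>

definition sources :: "(nat \<Rightarrow> nat) \<Rightarrow> nat \<Rightarrow> nat \<Rightarrow> nat list" where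
  "sources c j n = concat (map (\<lambda>l. replicate (c l) l) [j..<Suc (j + n)])"

lemma length_sources: "length (sources c j n) = (\<Sum>l=j..j+n. c l)"
  by (simp add: sources_def length_concat o_def sum_list_distinct_conv_sum_set atLeastLessThanSuc_atLeastAtMost
      del: upt_Suc)

lemma sum_sources: "(\<Sum>q<length (sources c j n). v (sources c j n ! q)) = (\<Sum>l=j..j+n. real (c l) * v l :: real)"
proof -
  have "(\<Sum>q<length xs. v (xs ! q)) = sum_list (map v xs)" for xs
    by (simp add: sum_list_sum_nth atLeast0LessThan)
  moreover have "sum_list (concat yss) = sum_list (map sum_list yss)" for yss :: "real list list"
    by (induction yss) auto
  ultimately show ?thesis
    by (simp add: sources_def map_concat o_def sum_list_replicate
        sum_list_distinct_conv_sum_set atLeastLessThanSuc_atLeastAtMost del: upt_Suc)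
qed

lemma card_sources:
  "card {q. q < length (sources c j n) \<and> sources c j n ! q = l} = (if l \<in> {j..j+n} then c l else 0)"
proof -
  let ?xs = "sources c j n"
  have "real (card {q. q < length ?xs \<and> ?xs ! q = l}) = (\<Sum>q<length ?xs. if ?xs ! q = l then 1 else 0)"
    by (simp add: sum.If_cases Int_def conj_commute)
  also have "\<dots> = (\<Sum>k=j..j+n. real (c k) * (if k = l then 1 else 0))"
    by (rule sum_sources[where v = "\<lambda>k. if k = l then 1 else 0"])
  also have "\<dots> = real (if l \<in> {j..j+n} then c l else 0)"
    by (simp add: if_distrib[of "\<lambda>u. _ * u"] cong: if_cong)
  finally show ?thesis by (simp only: of_nat_eq_iff)
qed

context symmetric_banach_space
begin

text \<open>
  Let \<open>S l = a l + ... + a (l + n)\<close>. Ideally the fraction \<open>a (j + n) / S l\<close> of level \<open>l\<close> is moved to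
  level \<open>j\<close>, for \<open>j\<close> between \<open>l - n\<close> and \<open>l\<close>; these fractions add up to at most \<open>1\<close>, and they carry
  mass at least \<open>a (j + n)\<close> from each of the \<open>n + 1\<close> levels \<open>l = j, ..., j + n\<close>. To have finitely many
  cells per level, the fractions are rounded up to multiples of \<open>1/(n + 1)\<close>. Their sum is then at
  most \<open>2\<close>, which the number of cells absorbs at the price of a factor \<open>2\<close> in the conclusion. The
  cell function so obtained has a distribution function below that of \<open>v\<close>, and averaging over
  the cells of each level gives the claim.
\<close>

lemma norm_shifted_levels_le:
  fixes a v :: "nat \<Rightarrow> real"
  assumes a: "\<And>i. 0 \<le> a i" and v: "\<And>l. (\<Sum>i=l..l+n. a i) \<le> v l / 2 ^ l"
    and vE: "dyadic_step v \<in> E"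
  shows "dyadic_step (\<lambda>j. 2 ^ j * a (j + n)) \<in> E"
    and "N (dyadic_step (\<lambda>j. 2 ^ j * a (j + n))) \<le> 2 / real (Suc n) * N (dyadic_step v)"
proof -
  interpret prob_space leb01 by (rule prob_space_leb01)
  \<comment> \<open>\<open>c j l\<close> is the number of cells of level \<open>j\<close> with source \<open>l\<close>; the power of \<open>2\<close> accounts for
    a cell of level \<open>j\<close> being \<open>2^(l - j)\<close> times as long as one of level \<open>l\<close>.\<close>
  define S where "S l = (\<Sum>i=l..l+n. a i)" for l
  define k where "k j l = nat \<lceil>real (Suc n) * a (j + n) / S l\<rceil>" for j l
  define c where "c j l = 2 ^ (n - (l - j)) * k j l" for j l
  define R where "R = 2 ^ Suc n * Suc n"
  define A where "A j q = (if q < length (sources (c j) j n) then v (sources (c j) j n ! q) else 0)" for j q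
  have R: "0 < R" by (simp add: R_def)
  have S0: "0 \<le> S l" for l unfolding S_def using a by (intro sum_nonneg) auto
  have aS: "a (j + n) \<le> S l" if "j \<le> l" "l \<le> j + n" for j l
    unfolding S_def using a that by (intro member_le_sum) auto
  have ratio0: "0 \<le> real (Suc n) * a (j + n) / S l" for j l using a S0 by simp
  have k_ge: "real (Suc n) * a (j + n) / S l \<le> real (k j l)" for j l
    unfolding k_def by (rule real_nat_ceiling_ge)
  have k_le: "real (k j l) \<le> real (Suc n) * a (j + n) / S l + 1" for j l
    unfolding k_def using ratio0[of j l] by linarith
  have k_le_n: "k j l \<le> Suc n" if "j \<le> l" "l \<le> j + n" for j l
  proof -
    have "a (j + n) / S l \<le> 1" using aS[OF that] S0[of l] by (auto simp: divide_le_eq_1)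
    then have "real (Suc n) * (a (j + n) / S l) \<le> real (Suc n) * 1" by (intro mult_left_mono) auto
    then have "\<lceil>real (Suc n) * a (j + n) / S l\<rceil> \<le> int (Suc n)" by (simp add: ceiling_le_iff)
    then show ?thesis unfolding k_def by linarith
  qed
  have len: "length (sources (c j) j n) \<le> R" for j
  proof -
    have "length (sources (c j) j n) \<le> (\<Sum>l=j..j+n. 2 ^ (n - (l - j)) * Suc n)"
      unfolding length_sources c_def using k_le_n by (intro sum_mono mult_left_mono) auto
    also have "\<dots> = (\<Sum>l=j..j+n. 2 ^ (n - (l - j))) * Suc n" by (simp only: sum_distrib_right)
    finally have below: "length (sources (c j) j n) \<le> (\<Sum>l=j..j+n. 2 ^ (n - (l - j))) * Suc n" .
    have "(\<Sum>l=j..j+n. 2 ^ (n - (l - j))) = (\<Sum>i<Suc n. 2 ^ i :: nat)"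
      by (rule sum.reindex_bij_witness[of _ "\<lambda>i. j + n - i" "\<lambda>l. n - (l - j)"]) auto
    also have "\<dots> \<le> 2 ^ Suc n"
    proof -
      have "(\<Sum>i<m. 2 ^ i :: nat) \<le> 2 ^ m" for m by (induction m) auto
      then show ?thesis .
    qed
    finally have "(\<Sum>l=j..j+n. 2 ^ (n - (l - j))) \<le> (2 ^ Suc n :: nat)" .
    then have "(\<Sum>l=j..j+n. 2 ^ (n - (l - j))) * Suc n \<le> R"
      unfolding R_def by (rule mult_right_mono) simp
    with below show ?thesis by linarith
  qed
  have source_measure: "measure leb01 {t \<in> {0<..<1}. dyadic_cell R t < length (sources (c (dyadic_level t)) (dyadic_level t) n) \<and>
      sources (c (dyadic_level t)) (dyadic_level t) n ! dyadic_cell R t = l} \<le> 1 / 2 ^ Suc l" (is "measure _ ?B \<le> _")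
    and source_sets: "{t \<in> {0<..<1}. dyadic_cell R t < length (sources (c (dyadic_level t)) (dyadic_level t) n) \<and>
      sources (c (dyadic_level t)) (dyadic_level t) n ! dyadic_cell R t = l} \<in> sets leb01" for l
  proof -
    let ?P = "\<lambda>j q. q < length (sources (c j) j n) \<and> sources (c j) j n ! q = l"
    show "?B \<in> sets leb01" using measure_cells(1)[OF R, of ?P] .
    define J where "J = {j. j \<le> l \<and> l \<le> j + n}"
    have J: "finite J" "card J \<le> Suc n"
    proof -
      have "J \<subseteq> {l - n..l}" by (auto simp: J_def)
      moreover have "card {l - n..l} \<le> Suc n" by simp
      ultimately show "finite J" "card J \<le> Suc n"
        using finite_subset card_mono[of "{l - n..l}" J] by auto
    qed
    have card: "card {q. q < R \<and> ?P j q} = (if j \<in> J then c j l else 0)" for j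
    proof -
      have "{q. q < R \<and> ?P j q} = {q. ?P j q}" using len[of j] by auto
      then show ?thesis using card_sources[of "c j" j n l] by (simp add: J_def)
    qed
    have "(\<lambda>j. real (card {q. q < R \<and> ?P j q}) / (real R * 2 ^ Suc j)) sums
        (\<Sum>j\<in>J. real (card {q. q < R \<and> ?P j q}) / (real R * 2 ^ Suc j))"
      by (rule sums_finite[OF J(1)]) (simp add: card)
    then have "measure leb01 ?B = (\<Sum>j\<in>J. real (card {q. q < R \<and> ?P j q}) / (real R * 2 ^ Suc j))"
      using measure_cells(2)[OF R, of ?P] by (rule sums_unique2[rotated])
    also have "\<dots> = (\<Sum>j\<in>J. 2 ^ n / (real R * 2 ^ Suc l) * real (k j l))"
    proof (rule sum.cong[OF refl])
      fix j assume j: "j \<in> J"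
      then have "n + Suc j = (n - (l - j)) + Suc l" by (auto simp: J_def)
      then have "(2::real) ^ n * 2 ^ Suc j = 2 ^ (n - (l - j)) * 2 ^ Suc l"
        by (simp only: power_add[symmetric])
      then show "real (card {q. q < R \<and> ?P j q}) / (real R * 2 ^ Suc j) = 2 ^ n / (real R * 2 ^ Suc l) * real (k j l)"
        using j R by (simp only: card if_True c_def) (simp add: field_simps)
    qed
    also have "\<dots> = 2 ^ n / (real R * 2 ^ Suc l) * (\<Sum>j\<in>J. real (k j l))"
      by (simp only: sum_distrib_left)
    finally have counted: "measure leb01 ?B = 2 ^ n / (real R * 2 ^ Suc l) * (\<Sum>j\<in>J. real (k j l))" .
    have total: "(\<Sum>j\<in>J. real (k j l)) \<le> 2 * real (Suc n)"
    proof -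
      have "(\<Sum>j\<in>J. a (j + n)) = (\<Sum>i\<in>(\<lambda>j. j + n) ` J. a i)"
        by (subst sum.reindex) (auto simp: inj_on_def)
      also have "\<dots> \<le> S l"
        unfolding S_def using a by (intro sum_mono2) (auto simp: J_def)
      finally have "(\<Sum>j\<in>J. a (j + n)) / S l \<le> 1" using S0[of l] by (auto simp: divide_le_eq_1)
      then have mass: "real (Suc n) * ((\<Sum>j\<in>J. a (j + n)) / S l) \<le> real (Suc n) * 1"
        by (intro mult_left_mono) auto
      have "(\<Sum>j\<in>J. real (k j l)) \<le> (\<Sum>j\<in>J. real (Suc n) * a (j + n) / S l + 1)"
        by (intro sum_mono k_le)
      also have "\<dots> = real (Suc n) * ((\<Sum>j\<in>J. a (j + n)) / S l) + real (card J)"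
        by (simp add: sum.distrib sum_divide_distrib sum_distrib_left del: of_nat_Suc)
      also have "\<dots> \<le> real (Suc n) * 1 + real (Suc n)"
        using J(2) by (intro add_mono mass) (simp only: of_nat_le_iff)
      finally show ?thesis by simp
    qed
    have "measure leb01 ?B \<le> 2 ^ n / (real R * 2 ^ Suc l) * (2 * real (Suc n))"
      unfolding counted by (rule mult_left_mono[OF total]) simp
    also have "\<dots> = 1 / 2 ^ Suc l"
    proof -
      have "real R = 2 ^ n * (2 * real (Suc n))" by (simp add: R_def algebra_simps)
      then have "2 ^ n / (real R * 2 ^ Suc l) * (2 * real (Suc n)) = real R / (real R * 2 ^ Suc l)"
        by (simp only: times_divide_eq_left)
      then show ?thesis using R by simp
    qed
    finally show "measure leb01 ?B \<le> 1 / 2 ^ Suc l" .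
  qed
  have "distribution_fun (cell_fun R A) s \<le> distribution_fun (dyadic_step v) s" if s: "0 \<le> s" for s
  proof -
    let ?B = "\<lambda>l. {t \<in> {0<..<1}. dyadic_cell R t < length (sources (c (dyadic_level t)) (dyadic_level t) n) \<and>
      sources (c (dyadic_level t)) (dyadic_level t) n ! dyadic_cell R t = l}"
    let ?D = "\<lambda>l. if s < \<bar>v l\<bar> then ?B l else {}"
    let ?u = "\<lambda>l. real (card {q. q < (1::nat) \<and> s < \<bar>v l\<bar>}) / (real (1::nat) * 2 ^ Suc l)"
    have u: "?u sums distribution_fun (dyadic_step v) s"
      unfolding dyadic_step_eq_cell_fun by (rule distribution_fun_cell_fun) simp
    have le: "measure leb01 (?D l) \<le> ?u l" for l
      using source_measure[of l] by (cases "s < \<bar>v l\<bar>") (simp_all del: power_Suc)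
    have summable: "summable (\<lambda>l. measure leb01 (?D l))"
      by (rule summable_comparison_test'[OF sums_summable[OF u], of 0]) (use le in simp)
    have D: "range ?D \<subseteq> sets leb01" using source_sets by auto
    have "distribution_fun (cell_fun R A) s \<le> measure leb01 (\<Union>l. ?D l)"
      unfolding distribution_fun_def
    proof (rule finite_measure_mono)
      show "{u \<in> {0<..<1}. s < \<bar>cell_fun R A u\<bar>} \<subseteq> (\<Union>l. ?D l)"
      proof
        fix t assume t: "t \<in> {u \<in> {0<..<1}. s < \<bar>cell_fun R A u\<bar>}"
        let ?j = "dyadic_level t" and ?q = "dyadic_cell R t"
        let ?l = "sources (c ?j) ?j n ! ?q"
        have "?q < length (sources (c ?j) ?j n)" "s < \<bar>v ?l\<bar>"
          using t s by (auto simp: cell_fun_def A_def split: if_splits)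
        then have "t \<in> ?D ?l" using t by simp
        then show "t \<in> (\<Union>l. ?D l)" by blast
      qed
    qed (use D in blast)
    also have "\<dots> \<le> (\<Sum>l. measure leb01 (?D l))"
      by (rule finite_measure_subadditive_countably[OF D summable])
    also have "\<dots> \<le> (\<Sum>l. ?u l)"
      by (rule suminf_le[OF le summable sums_summable[OF u]])
    also have "\<dots> = distribution_fun (dyadic_step v) s" using u by (rule sums_unique[symmetric])
    finally show ?thesis .
  qed
  from distribution_le_imp_norm_le[OF vE cell_fun_measurable[OF R] this]
  have AE: "cell_fun R A \<in> E" and AN: "N (cell_fun R A) \<le> N (dyadic_step v)" by auto
  note avg = norm_level_average_le[OF R AE]
  let ?u = "dyadic_step (\<lambda>j. 2 ^ j * a (j + n))"
  have average: "real (Suc n) / 2 * (2 ^ j * a (j + n)) \<le> (\<Sum>q<R. A j q) / R" for j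
  proof -
    have "(\<Sum>q<R. A j q) = (\<Sum>q<length (sources (c j) j n). v (sources (c j) j n ! q))"
      unfolding A_def using len[of j] by (intro sum.mono_neutral_cong_right) auto
    also have "\<dots> = (\<Sum>l=j..j+n. real (c j l) * v l)" by (rule sum_sources)
    finally have eq: "(\<Sum>q<R. A j q) = (\<Sum>l=j..j+n. real (c j l) * v l)" .
    have "2 ^ (n + j) * (real (Suc n) * a (j + n)) \<le> real (c j l) * v l" if l: "l \<in> {j..j+n}" for l
    proof -
      have "real (Suc n) * a (j + n) / S l * S l \<le> real (k j l) * S l"
        by (intro mult_right_mono k_ge S0)
      moreover have "real (Suc n) * a (j + n) / S l * S l = real (Suc n) * a (j + n)"
        using aS[of j l] a[of "j + n"] l by (cases "S l = 0") auto
      ultimately have 1: "real (Suc n) * a (j + n) \<le> real (k j l) * S l" by simp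
      have "S l * 2 ^ l \<le> v l" using v[of l] by (simp add: S_def field_simps)
      then have 2: "real (c j l) * (S l * 2 ^ l) \<le> real (c j l) * v l" by (intro mult_left_mono) auto
      have "n + j = (n - (l - j)) + l" using l by auto
      then have "(2::real) ^ (n + j) = 2 ^ (n - (l - j)) * 2 ^ l" by (simp only: power_add[symmetric])
      then have 3: "real (c j l) * (S l * 2 ^ l) = 2 ^ (n + j) * (real (k j l) * S l)"
        by (simp add: c_def)
      have "2 ^ (n + j) * (real (Suc n) * a (j + n)) \<le> 2 ^ (n + j) * (real (k j l) * S l)"
        by (rule mult_left_mono[OF 1]) simp
      then show ?thesis using 2 unfolding 3 by (rule order_trans)
    qed
    then have "(\<Sum>l=j..j+n. 2 ^ (n + j) * (real (Suc n) * a (j + n))) \<le> (\<Sum>q<R. A j q)"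
      unfolding eq by (rule sum_mono)
    moreover have "(\<Sum>l=j..j+n. 2 ^ (n + j) * (real (Suc n) * a (j + n))) =
       real (Suc n) / 2 * (2 ^ j * a (j + n)) * real R"
      by (simp add: R_def power_add field_simps)
    ultimately have "real (Suc n) / 2 * (2 ^ j * a (j + n)) * real R \<le> (\<Sum>q<R. A j q)" by (simp only:)
    then show ?thesis using R by (simp only: pos_le_divide_eq of_nat_0_less_iff)
  qed
  have small: "AE t in leb01. \<bar>real (Suc n) / 2 * ?u t\<bar> \<le> \<bar>dyadic_step (\<lambda>j. (\<Sum>q<R. A j q) / R) t\<bar>"
  proof (rule AE_I2)
    fix t
    have "0 \<le> real (Suc n) / 2 * ?u t" using a by (simp add: dyadic_step_def)
    moreover have "real (Suc n) / 2 * ?u t \<le> dyadic_step (\<lambda>j. (\<Sum>q<R. A j q) / R) t"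
      unfolding dyadic_step_def by (rule average)
    ultimately show "\<bar>real (Suc n) / 2 * ?u t\<bar> \<le> \<bar>dyadic_step (\<lambda>j. (\<Sum>q<R. A j q) / R) t\<bar>" by linarith
  qed
  have m: "(\<lambda>t. real (Suc n) / 2 * ?u t) \<in> borel_measurable leb01"
    by (intro borel_measurable_times borel_measurable_const dyadic_step_measurable)
  note mono = norm_mono[OF avg(1) m small]
  have u_eq: "?u = (\<lambda>t. 2 / real (Suc n) * (real (Suc n) / 2 * ?u t))"
    by (simp del: of_nat_Suc)
  show "?u \<in> E" by (subst u_eq) (rule scale_mem[OF mono(1)])
  have "N ?u = 2 / real (Suc n) * N (\<lambda>t. real (Suc n) / 2 * ?u t)"
    using norm_scale[OF mono(1), of "2 / real (Suc n)"] unfolding u_eq[symmetric]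
    by (simp only: abs_of_nonneg divide_nonneg_nonneg zero_le_numeral of_nat_0_le_iff)
  also have "\<dots> \<le> 2 / real (Suc n) * N (dyadic_step v)"
    using mono(2) avg(2) AN by (intro mult_left_mono) auto
  finally show "N ?u \<le> 2 / real (Suc n) * N (dyadic_step v)" .
qed

text \<open>
  A large dilation of the nonzero decreasing function \<open>\<mu>(x)\<close> is bounded below by a positive constant
  on all of \<open>(0,1)\<close>.
\<close>

lemma const_mem:
  assumes x: "x \<in> E" and nz: "N x \<noteq> 0"
  shows "(\<lambda>t. c) \<in> E"
proof -
  note xm = measurable_E[OF x]
  interpret prob_space leb01 by (rule prob_space_leb01)
  have "distribution_fun x 0 \<noteq> 0"
  proof
    assume "distribution_fun x 0 = 0"
    then have "AE t in leb01. t \<notin> {u \<in> {0<..<1}. \<bar>x u\<bar> > 0}"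
      unfolding distribution_fun_def using superlevel_sets[OF xm, of 0]
      by (intro AE_not_in) (simp add: null_sets_def emeasure_eq_measure)
    then have "AE t in leb01. x t = 0" using AE_space by eventually_elim auto
    then show False using norm_eq_zero_iff[OF x] nz by simp
  qed
  then have d: "0 < distribution_fun x 0" using distribution_fun_nonneg[of x 0] by linarith
  then obtain k where k: "inverse (real (Suc k)) < distribution_fun x 0"
    using reals_Archimedean by blast
  let ?m = "Suc k"
  let ?f = "dilation ?m (decreasing_rearrangement x)"
  define b where "b = decreasing_rearrangement x (1 / real ?m)"
  have b: "0 < b" unfolding b_def
    using decreasing_rearrangement_gt_iff[OF xm, of "1 / real ?m" 0] k by (simp add: inverse_eq_divide)
  have fE: "?f \<in> E" by (rule dilation_mem[OF x]) simp
  have big: "AE t in leb01. \<bar>c\<bar> \<le> \<bar>\<bar>c\<bar> / b * ?f t\<bar>"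
  proof (rule AE_I2)
    fix t assume t: "t \<in> space leb01"
    then have "b \<le> ?f t" unfolding b_def dilation_def
      by (intro decreasing_rearrangement_antimono[OF xm]) (auto simp: divide_right_mono simp del: of_nat_Suc)
    then have "\<bar>c\<bar> / b * b \<le> \<bar>c\<bar> / b * ?f t" using b by (intro mult_left_mono) auto
    moreover have "\<bar>c\<bar> / b * b = \<bar>c\<bar>" using b by simp
    ultimately show "\<bar>c\<bar> \<le> \<bar>\<bar>c\<bar> / b * ?f t\<bar>" by linarith
  qed
  show ?thesis by (rule norm_mono(1)[OF scale_mem[OF fE] _ big]) simp
qed

text \<open>
  This applies to the majorants in \<open>dyadic_sum_le\<close>. The point \<open>1/2^l\<close> lies to the right of level
  \<open>l\<close>, where \<open>\<mu>(g)\<close> is smaller.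
\<close>

lemma dyadic_bound_mem:
  assumes x: "x \<in> E" "N x \<noteq> 0" and g: "g \<in> E" and "0 \<le> \<alpha>" "0 \<le> \<beta>"
  shows "dyadic_step (\<lambda>l. \<alpha> * decreasing_rearrangement g (1 / 2 ^ l) + \<beta>) \<in> E"
proof -
  note gm = measurable_E[OF g]
  have H: "(\<lambda>t. \<alpha> * decreasing_rearrangement g t + \<beta>) \<in> E"
    by (intro add_mem scale_mem decreasing_rearrangement_mem(1)[OF g] const_mem[OF x])
  show ?thesis
  proof (rule norm_mono(1)[OF H dyadic_step_measurable], rule AE_I2)
    fix t assume "t \<in> space leb01"
    then have t: "0 < t" "t < 1" by auto
    let ?p = "1 / 2 ^ dyadic_level t :: real"
    have "t < ?p" using dyadic_level_iff[OF t, of "dyadic_level t"] by simp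
    then have "decreasing_rearrangement g ?p \<le> decreasing_rearrangement g t"
      using t by (intro decreasing_rearrangement_antimono[OF gm]) auto
    then have "\<alpha> * decreasing_rearrangement g ?p \<le> \<alpha> * decreasing_rearrangement g t"
      using assms by (intro mult_left_mono)
    moreover have "0 \<le> decreasing_rearrangement g ?p"
      by (rule decreasing_rearrangement_nonneg[OF gm]) simp
    then have "0 \<le> \<alpha> * decreasing_rearrangement g ?p" using assms by simp
    ultimately show "\<bar>dyadic_step (\<lambda>l. \<alpha> * decreasing_rearrangement g (1 / 2 ^ l) + \<beta>) t\<bar>
        \<le> \<bar>\<alpha> * decreasing_rearrangement g t + \<beta>\<bar>"
      using assms by (simp add: dyadic_step_def)
  qed
qed

text \<open>
  On level \<open>j\<close> the dilation of \<open>F = \<mu>(x)\<close> by \<open>2^n\<close> is at most \<open>F(1/2^(j+n+1))\<close>, which is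
  \<open>2^(n+1)\<close> times the value on level \<open>j\<close> of the step function bounded by \<open>norm_shifted_levels_le\<close>.
\<close>

lemma small_truncations_norm_dilation_le:
  assumes x: "x \<in> small_truncations" and x0: "AE t in leb01. 0 \<le> x t" and nz: "N x \<noteq> 0"
  obtains C where "\<And>n. N (dilation (2 ^ n) (decreasing_rearrangement x)) / 2 ^ n \<le> C / real (Suc n)"
proof -
  have xE: "x \<in> E" using x by (simp add: small_truncations_def)
  note xm = measurable_E[OF xE]
  obtain g K where g: "g \<in> E" "0 \<le> K" and sum_le:
    "\<And>l n. (\<Sum>i=l..l+n. decreasing_rearrangement x (1 / 2 ^ i) / 2 ^ i) \<le>
       (2 * (K + 1) * decreasing_rearrangement g (1 / 2 ^ l) + 2 * K) / 2 ^ l"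
    using dyadic_sum_le[OF x x0] by blast
  define a where "a i = decreasing_rearrangement x (1 / 2 ^ i) / 2 ^ i" for i :: nat
  define v where "v l = 2 * (K + 1) * decreasing_rearrangement g (1 / 2 ^ l) + 2 * K" for l :: nat
  have a: "0 \<le> a i" for i unfolding a_def using decreasing_rearrangement_nonneg[OF xm] by simp
  have v: "(\<Sum>i=l..l+n. a i) \<le> v l / 2 ^ l" for l n unfolding a_def v_def by (rule sum_le)
  have vE: "dyadic_step v \<in> E"
    unfolding v_def by (rule dyadic_bound_mem[OF xE nz g(1)]) (use g(2) in auto)
  have "N (dilation (2 ^ n) (decreasing_rearrangement x)) / 2 ^ n \<le> 4 * N (dyadic_step v) / real (Suc n)" for n
  proof -
    let ?f = "dilation (2 ^ n) (decreasing_rearrangement x)"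
    let ?u = "dyadic_step (\<lambda>j. 2 ^ j * a (j + Suc n))"
    note u = norm_shifted_levels_le[OF a v vE, of "Suc n"]
    have small: "AE t in leb01. \<bar>?f t\<bar> \<le> \<bar>2 ^ Suc n * ?u t\<bar>"
    proof (rule AE_I2)
      fix t assume "t \<in> space leb01"
      then have t: "0 < t" "t < 1" by auto
      let ?j = "dyadic_level t"
      have "1 / 2 ^ Suc ?j \<le> t" using dyadic_level_iff[OF t, of ?j] by simp
      then have "1 / 2 ^ Suc ?j / 2 ^ n \<le> t / 2 ^ n" by (intro divide_right_mono) auto
      then have "1 / 2 ^ (?j + Suc n) \<le> t / 2 ^ n" by (simp add: power_add)
      then have "decreasing_rearrangement x (t / 2 ^ n) \<le> decreasing_rearrangement x (1 / 2 ^ (?j + Suc n))"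
        by (intro decreasing_rearrangement_antimono[OF xm]) auto
      also have "\<dots> = 2 ^ Suc n * ?u t"
        by (simp add: dyadic_step_def a_def power_add)
      finally have "?f t \<le> 2 ^ Suc n * ?u t" by (simp add: dilation_def)
      moreover have "0 \<le> ?f t"
        unfolding dilation_def using t by (intro decreasing_rearrangement_nonneg[OF xm]) auto
      ultimately show "\<bar>?f t\<bar> \<le> \<bar>2 ^ Suc n * ?u t\<bar>" by linarith
    qed
    have "N ?f \<le> N (\<lambda>t. 2 ^ Suc n * ?u t)"
      by (rule norm_mono(2)[OF scale_mem[OF u(1)] dilation_measurable[OF xE] small]) simp
    also have "\<dots> = 2 ^ Suc n * N ?u" by (subst norm_scale[OF u(1)]) simp
    also have "\<dots> \<le> 2 ^ Suc n * (2 / real (Suc (Suc n)) * N (dyadic_step v))"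
      by (intro mult_left_mono u(2)) auto
    also have "\<dots> \<le> 2 ^ Suc n * (2 / real (Suc n) * N (dyadic_step v))"
      by (intro mult_left_mono mult_right_mono divide_left_mono norm_nonneg[OF vE]) auto
    also have "\<dots> = 2 ^ n * (4 * N (dyadic_step v) / real (Suc n))" by simp
    finally show ?thesis by (simp add: divide_le_eq mult.commute)
  qed
  then show thesis by (rule that)
qed

end

section \<open>Existence of the functional\<close>

context symmetric_banach_space
begin

theorem singular_symmetric_functional_exists:
  assumes x: "x \<in> E" and x0: "AE t in leb01. 0 \<le> x t"
  shows "\<exists>\<phi>. linear_functional_on E \<phi> \<and> symmetric_functional_on E \<phi> \<and>
           singular_functional_on E \<phi> \<and>
           (\<lambda>m. 1 / real m * N (dilation m (decreasing_rearrangement x))) \<longlonglongrightarrow> \<phi> x"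
proof -
  let ?p = "\<lambda>m. N (dilation m (decreasing_rearrangement x))"
  obtain L where L: "(\<lambda>m. 1 / real m * ?p m) \<longlonglongrightarrow> L" "0 \<le> L" "\<And>n. 0 < n \<Longrightarrow> L \<le> ?p n / real n"
    using averages_converge[of ?p] norm_nonneg[OF dilation_mem[OF x]]
      norm_dilation_mono[OF x] norm_dilation_mult_le[OF x] by blast
  show ?thesis
  proof (cases "L = 0")
    case True
    then show ?thesis
      using L(1) by (intro exI[of _ "\<lambda>_. 0"])
        (auto simp: linear_functional_on_def symmetric_functional_on_def singular_functional_on_def)
  next
    case False
    have "x \<notin> small_truncations"
    proof
      assume xs: "x \<in> small_truncations"
      have "N x \<noteq> 0"
        using L(3)[of 1] L(2) False decreasing_rearrangement_mem(2)[OF x] by simp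
      then obtain C where C: "\<And>n. ?p (2 ^ n) / 2 ^ n \<le> C / real (Suc n)"
        using small_truncations_norm_dilation_le[OF xs x0] by blast
      have "L \<le> C / real (Suc n)" for n
        using L(3)[of "2 ^ n"] C[of n] by simp
      moreover have "(\<lambda>n. C / real (Suc n)) \<longlonglongrightarrow> 0"
        using LIMSEQ_inverse_real_of_nat tendsto_mult_right_zero[of _ sequentially C]
        by (fastforce simp: divide_inverse)
      ultimately have "L \<le> 0" by (intro LIMSEQ_le_const) auto
      then show False using L(2) False by simp
    qed
    then obtain \<phi> where add: "\<And>f g. \<phi> (\<lambda>t. f t + g t) = \<phi> f + \<phi> g"
      and scale: "\<And>c f. \<phi> (\<lambda>t. c * f t) = c * \<phi> f"
      and zero: "\<And>f. f \<in> small_truncations \<Longrightarrow> \<phi> f = 0" and \<phi>x: "\<phi> x = L"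
      using exists_linear_functional[OF small_truncations_zero small_truncations_add
          small_truncations_scale, of x L] by blast
    have diff: "\<phi> y = \<phi> z" if "(\<lambda>t. y t - z t) \<in> small_truncations" for y z
      using add[of "\<lambda>t. y t - z t" z] zero[OF that] by simp
    have "linear_functional_on E \<phi>"
      unfolding linear_functional_on_def
    proof (intro conjI ballI allI impI add scale)
      fix y z assume yz: "y \<in> E" "z \<in> E" and eq: "AE t in leb01. y t = z t"
      have "(\<lambda>t. y t + (-1) * z t) \<in> E" by (intro add_mem scale_mem yz)
      then have "(\<lambda>t. y t - z t) \<in> E" by simp
      then show "\<phi> y = \<phi> z"
        by (intro diff bounded_in_small_truncations[of _ 0]) (use eq in auto)
    qed
    moreover have "symmetric_functional_on E \<phi>"
      unfolding symmetric_functional_on_def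
      by (intro ballI impI diff equimeasurable_diff_in_small_truncations)
    moreover have "singular_functional_on E \<phi>"
      unfolding singular_functional_on_def using bounded_in_small_truncations zero by blast
    ultimately show ?thesis using L(1) \<phi>x by blast
  qed
qed

end

theorem theorem29:
  fixes E :: "(real \<Rightarrow> real) set" and N :: "(real \<Rightarrow> real) \<Rightarrow> real" and x :: "real \<Rightarrow> real"
  assumes "symmetric_banach_space E N"
    and "x \<in> E" and "AE t in leb01. 0 \<le> x t"
  shows "\<exists>\<phi>. linear_functional_on E \<phi> \<and> symmetric_functional_on E \<phi> \<and>
           singular_functional_on E \<phi> \<and>
           (\<lambda>m. 1 / real m * N (dilation m (decreasing_rearrangement x))) \<longlonglongrightarrow> \<phi> x"
  using symmetric_banach_space.singular_symmetric_functional_exists[OF assms] .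

end
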